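(* For all integers $n \geq 1$, all partitions $\lambda \vdash n$ and all $r \in \mathbb{Z}/n$, $$\left|\frac{a_{\lambda,r}}{f^\lambda} - \frac{1}{n}\right| \leq \frac{2 n^{3/2}}{\sqrt{f^\lambda}}.$$
   Context: $\lambda \vdash n$ means that $\lambda$ is an integer partition of $n$. A standard Young tableau of shape $\lambda \vdash n$ is a filling of the Young diagram of $\lambda$ with $1,\ldots,n$, each used once, increasing along rows and along columns going away from the corner cell; $\operatorname{SYT}(\lambda)$ is the set of these and $f^\lambda = \#\operatorname{SYT}(\lambda)$. A descent of $T$ is an $i \in \{1,\ldots,n-1\}$ such that $i+1$ lies in a row of strictly larger index than the row of $i$ (the $j$th row has $\lambda_j$ cells), and $\operatorname{maj} T$ is the sum of the descents of $T$. $a_{\lambda,r} = \#\{T \in \operatorname{SYT}(\lambda) : \operatorname{maj} T \equiv r \pmod n\}$. *)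

theory Defs
  imports Complex_Main "HOL-Library.FuncSet" "HOL-Number_Theory.Cong"
begin

definition partition_of :: "nat list \<Rightarrow> nat \<Rightarrow> bool"  (infix "\<turnstile>" 50) where
  "lam \<turnstile> n \<longleftrightarrow> sorted_wrt (\<ge>) lam \<and> (\<forall>p\<in>set lam. p > 0) \<and> sum_list lam = n"

(* Cells are pairs (row, column), both counted from 0; the corner cell is (0, 0). *)
definition diagram :: "nat list \<Rightarrow> (nat \<times> nat) set" where
  "diagram lam = {(i, j). i < length lam \<and> j < lam ! i}"

(* Extensionality fixes the values outside the diagram, so that
   distinct members of SYT are distinct fillings. *)
definition SYT :: "nat list \<Rightarrow> (nat \<times> nat \<Rightarrow> nat) set" where
  "SYT lam = {T \<in> extensional (diagram lam).
     bij_betw T (diagram lam) {1..sum_list lam} \<and>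
     (\<forall>i j j'. (i, j) \<in> diagram lam \<and> (i, j') \<in> diagram lam \<and> j < j' \<longrightarrow> T (i, j) < T (i, j')) \<and>
     (\<forall>i i' j. (i, j) \<in> diagram lam \<and> (i', j) \<in> diagram lam \<and> i < i' \<longrightarrow> T (i, j) < T (i', j))}"

definition num_SYT :: "nat list \<Rightarrow> nat" where
  "num_SYT lam = card (SYT lam)"

definition descents :: "nat list \<Rightarrow> (nat \<times> nat \<Rightarrow> nat) \<Rightarrow> nat set" where
  "descents lam T = {k \<in> {1..<sum_list lam}.
     \<exists>i j i' j'. (i, j) \<in> diagram lam \<and> (i', j') \<in> diagram lam \<and>
       T (i, j) = k \<and> T (i', j') = k + 1 \<and> i < i'}"

definition maj :: "nat list \<Rightarrow> (nat \<times> nat \<Rightarrow> nat) \<Rightarrow> nat" where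
  "maj lam T = \<Sum>(descents lam T)"

(* The residue class r is given by an arbitrary integer representative. *)
definition num_SYT_maj :: "nat list \<Rightarrow> int \<Rightarrow> nat" where
  "num_SYT_maj lam r = card {T \<in> SYT lam. [int (maj lam T) = r] (mod int (sum_list lam))}"

lemma finite_diagram: "finite (diagram lam)"
proof -
  have "diagram lam = (SIGMA i:{..<length lam}. {..<lam ! i})"
    by (auto simp: diagram_def)
  then show ?thesis by simp
qed

lemma finite_SYT: "finite (SYT lam)"
proof (rule finite_subset)
  show "SYT lam \<subseteq> diagram lam \<rightarrow>\<^sub>E {1..sum_list lam}"
    by (auto simp: SYT_def PiE_def bij_betw_def)
  show "finite (diagram lam \<rightarrow>\<^sub>E {1..sum_list lam})"
    by (intro finite_PiE finite_diagram) simp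
qed

end

theory Submission
  imports Defs "Jordan_Normal_Form.Determinant"
begin

text \<open>
  Write \<open>P(q) = \<Sum>_T q^(maj T)\<close> for the generating polynomial of the major index over the standard
  tableaux \<open>T\<close> of shape \<open>lam\<close>, and \<open>f = P(1)\<close> for their number.  Averaging \<open>P\<close> against the
  \<open>n\<close>-th roots of unity extracts the number of tableaux in one residue class; the root \<open>1\<close>
  contributes the main term \<open>f / n\<close>, so it suffices to show that \<open>|P(w)| \<le> (n + 1) * sqrt f\<close> for
  every \<open>n\<close>-th root of unity \<open>w \<noteq> 1\<close>.

  The polynomial has a product form.  Refine \<open>P\<close> by the row of the largest entry; deleting that
  entry gives a recursion for the refined polynomials, and a determinant of Jacobi-Trudi type, some
  of whose rows are multiplied by powers of \<open>q\<close>, satisfies the same recursion because of the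
  one-line identity \<open>1 / (q)_k - q^k / (q)_k = 1 / (q)_(k-1)\<close> for the entries and the linearity of
  a determinant in one row (\<open>q_fact_mult_jt_det_eq_maj_poly\<close>).  The determinant is of Vandermonde
  type.  With the set \<open>X\<close> of beta-numbers \<open>lam_r + (m - 1 - r)\<close>, where \<open>m\<close> is the number of
  rows, and its inversions \<open>(x, y)\<close>, \<open>x \<in> X\<close>, \<open>y \<notin> X\<close>, \<open>y < x\<close>, whose differences are the
  hook lengths, this is the q-hook formula: up to a power of \<open>q\<close>, the product of \<open>P(q)\<close> with all
  \<open>1 - q^(x - y)\<close> is the product of all \<open>1 - q^j\<close>, \<open>j \<le> n\<close> (\<open>norm_q_hook_formula\<close>, in
  modulus and for \<open>|q| < 1\<close>).

  Now let \<open>q\<close> tend radially to a primitive \<open>l\<close>-th root of unity \<open>w\<close>, where \<open>n = l * s\<close>.  For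
  \<open>l = 1\<close> one obtains the hook length formula.  In general \<open>P(w) = 0\<close> unless exactly \<open>s\<close> hook
  lengths are multiples of \<open>l\<close>.  In that case, if the shape has been padded with empty rows to \<open>n\<close>
  rows, \<open>X\<close> meets all residue classes modulo \<open>l\<close> equally often (\<open>residue_balanced\<close>).  Therefore
  all factors that do not tend to zero cancel, and \<open>|P(w)|\<close> times the product of the hook lengths
  divisible by \<open>l\<close> equals
  \<open>l * (2 * l) * \<dots> * (s * l)\<close> (\<open>norm_maj_poly_mult_prod_congruent\<close>).

  What remains is the inequality of Fomin and Lulov: if exactly \<open>s\<close> hook lengths are multiples of
  \<open>l\<close>, the product of all hook lengths is at most the \<open>l\<close>-th power of the product of these
  multiples (\<open>hook_product_inequality\<close>).  The logarithm
  is concave, so up to an affine function \<open>- ln h\<close> is a nonnegative combination of tents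
  \<open>max 0 (k - h)\<close>.  A tent evaluated at a distance counts the windows of \<open>k\<close> consecutive integers
  that contain both points, so the tent sums over hook lengths turn into sums over windows.  In one
  window, let \<open>n_r\<close> and \<open>n'_r\<close> count the members and the non-members of \<open>X\<close> in the class \<open>r\<close>.
  The defect of the inequality is then a sum over windows of
  \<open>(\<Sum> n_r) * (\<Sum> n'_r) - l * \<Sum> (n_r * n'_r)\<close>, which for given totals is smallest when
  the counts are evenly spread.
  Every number between \<open>0\<close> and \<open>k\<close> occurs as the number of members in some window, because this
  number changes by at most one when the window moves by one; hence the sum is at least the one for
  an initial segment of the integers, for which there are no hooks at all.
\<close>

section \<open>A row-linear expansion and a Vandermonde determinant\<close>

text \<open>
  Laplace expansion along row \<open>i\<close>: the cofactors do not see the row that changes.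
\<close>

lemma det_row_linear:
  fixes a b c :: "nat \<Rightarrow> 'a :: comm_ring_1" and M :: "nat \<Rightarrow> nat \<Rightarrow> 'a"
  assumes "i < m" "\<And>j. j < m \<Longrightarrow> a j - b j = c j"
  shows "det (mat m m (\<lambda>(r, j). if r = i then a j else M r j)) - det (mat m m (\<lambda>(r, j). if r = i then b j else M r j))
     = det (mat m m (\<lambda>(r, j). if r = i then c j else M r j))"
proof -
  define A where "A v = mat m m (\<lambda>(r, j). if r = i then v j else M r j)" for v :: "nat \<Rightarrow> 'a"
  have A: "A v \<in> carrier_mat m m" for v by (simp add: A_def)
  have del: "mat_delete (A v) i j = mat_delete (A c) i j" if "j < m" for v j
    using assms(1) that by (intro eq_matI) (auto simp: A_def mat_delete_def)
  have ex: "det (A v) = (\<Sum>j<m. v j * cofactor (A c) i j)" for v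
  proof -
    have "det (A v) = (\<Sum>j<m. A v $$ (i, j) * cofactor (A v) i j)"
      by (rule laplace_expansion_row[OF A assms(1)])
    also have "\<dots> = (\<Sum>j<m. v j * cofactor (A c) i j)"
    proof (rule sum.cong[OF refl])
      fix j assume "j \<in> {..<m}"
      then show "A v $$ (i, j) * cofactor (A v) i j = v j * cofactor (A c) i j"
        using assms(1) del[of j v] by (simp add: cofactor_def) (simp add: A_def)
    qed
    finally show ?thesis .
  qed
  have "det (A a) - det (A b) = det (A c)"
    unfolding ex[of a] ex[of b] ex[of c] sum_subtractf[symmetric]
    by (rule sum.cong) (simp_all add: assms(2)[symmetric] left_diff_distrib)
  then show ?thesis by (simp add: A_def)
qed

text \<open>
  As a function of its first node, the determinant is a polynomial of degree at most \<open>m - 1\<close>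
  that vanishes at all other nodes, where two rows coincide; its top coefficient is the
  determinant with the first row and the first column deleted.
\<close>

lemma det_generalized_Vandermonde:
  fixes p :: "nat \<Rightarrow> 'a :: {idom, ring_char_0} poly"
  assumes "\<And>j. j < m \<Longrightarrow> degree (p j) \<le> m - Suc j" "inj_on y {..<m}"
  shows "det (mat m m (\<lambda>(r, j). poly (p j) (y r))) =
    (\<Prod>j<m. coeff (p j) (m - Suc j)) * (\<Prod>r<m. \<Prod>s\<in>{r<..<m}. y r - y s)"
  using assms
proof (induction m arbitrary: p y)
  case 0
  then show ?case by simp
next
  case (Suc m)
  define M where "M = mat (Suc m) (Suc m) (\<lambda>(r, j). poly (p j) (y r))"
  define Q where "Q = (\<Sum>j<Suc m. smult (cofactor M 0 j) (p j))"
  have Mz: "det (mat (Suc m) (Suc m) (\<lambda>(r, j). if r = 0 then poly (p j) z else poly (p j) (y r))) = poly Q z" for z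
  proof -
    let ?N = "mat (Suc m) (Suc m) (\<lambda>(r, j). if r = 0 then poly (p j) z else poly (p j) (y r))"
    have "mat_delete ?N 0 j = mat_delete M 0 j" if "j < Suc m" for j
      using that by (intro eq_matI) (auto simp: M_def mat_delete_def)
    then show ?thesis
      by (subst laplace_expansion_row[of _ "Suc m" 0])
         (auto simp: Q_def poly_sum cofactor_def mult.commute intro!: sum.cong simp del: sum.lessThan_Suc)
  qed
  have detM: "det M = poly Q (y 0)"
    unfolding Mz[symmetric] M_def by (intro arg_cong[where f = det] eq_matI) auto
  have deg: "degree Q \<le> m"
    unfolding Q_def by (intro degree_sum_le) (auto intro!: order.trans[OF degree_smult_le] order.trans[OF Suc.prems(1)])
  have cof: "cofactor M 0 0 = (\<Prod>j<m. coeff (p (Suc j)) (m - Suc j)) * (\<Prod>r<m. \<Prod>s\<in>{r<..<m}. y (Suc r) - y (Suc s))"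
  proof -
    have "mat_delete M 0 0 = mat m m (\<lambda>(r, j). poly (p (Suc j)) (y (Suc r)))"
      by (intro eq_matI) (auto simp: M_def mat_delete_def)
    then show ?thesis unfolding cofactor_def
      using Suc.IH[of "\<lambda>j. p (Suc j)" "\<lambda>r. y (Suc r)"] Suc.prems by (auto simp: inj_on_def)
  qed
  define c where "c = coeff (p 0) m * cofactor M 0 0"
  have cQ: "coeff Q m = c"
  proof -
    have "coeff (p (Suc j)) m = 0" if "j < m" for j
      using Suc.prems(1)[of "Suc j"] that by (intro coeff_eq_0) auto
    then show ?thesis
      by (simp add: Q_def coeff_sum c_def sum.lessThan_Suc_shift del: sum.lessThan_Suc)
  qed
  \<comment> \<open>Q and c * R have the same top coefficient and agree at m points\<close>
  define R where "R = (\<Prod>s\<in>{0<..m}. [:- y s, 1:])"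
  have degR: "degree R = m" "coeff R m = 1"
  proof -
    have "degree R = (\<Sum>s\<in>{0<..m}. degree [:- y s, 1:])" unfolding R_def by (rule degree_prod_eq_sum_degree) auto
    then show "degree R = m" by simp
    moreover have "lead_coeff R = 1" unfolding R_def by (simp add: lead_coeff_prod)
    ultimately show "coeff R m = 1" by simp
  qed
  have "Q = smult c R"
  proof (rule ccontr)
    assume ne: "Q \<noteq> smult c R"
    define D where "D = Q - smult c R"
    have D: "D \<noteq> 0" using ne by (simp add: D_def)
    have "degree D \<le> m" using deg degR unfolding D_def by (intro degree_diff_le) auto
    moreover have "coeff D m = 0" by (simp add: D_def cQ degR)
    ultimately have dD: "degree D < m \<or> m = 0" using D
      by (metis le_neq_implies_less leading_coeff_0_iff)
    have m: "m \<noteq> 0"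
    proof
      assume "m = 0"
      then have "degree D = 0" "coeff D 0 = 0" using \<open>degree D \<le> m\<close> \<open>coeff D m = 0\<close> by auto
      then show False using D by (metis leading_coeff_0_iff)
    qed
    have "y ` {0<..m} \<subseteq> {x. poly D x = 0}"
    proof clarify
      fix s assume s: "s \<in> {0<..m}"
      let ?N = "mat (Suc m) (Suc m) (\<lambda>(r, j). if r = 0 then poly (p j) (y s) else poly (p j) (y r))"
      have "det ?N = 0"
        by (rule det_identical_rows[of _ "Suc m" 0 s]) (use s in \<open>auto intro!: eq_vecI\<close>)
      then have "poly Q (y s) = 0" by (simp add: Mz)
      moreover have "poly R (y s) = 0" using s by (auto simp: R_def poly_prod intro!: bexI[of _ s])
      ultimately show "poly D (y s) = 0" by (simp add: D_def)
    qed
    then have "card (y ` {0<..m}) \<le> card {x. poly D x = 0}"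
      using poly_roots_finite[OF D] by (intro card_mono) auto
    also have "\<dots> \<le> degree D" by (rule card_poly_roots_bound[OF D])
    finally have "m \<le> degree D"
      using Suc.prems(2) by (subst (asm) card_image) (auto simp: inj_on_def)
    then show False using dD m by simp
  qed
  then have "det M = c * (\<Prod>s\<in>{0<..m}. y 0 - y s)"
    by (simp add: detM R_def poly_prod)
  moreover have "(\<Prod>r<Suc m. \<Prod>s\<in>{r<..<Suc m}. y r - y s) =
     (\<Prod>s\<in>{0<..m}. y 0 - y s) * (\<Prod>r<m. \<Prod>s\<in>{r<..<m}. y (Suc r) - y (Suc s))"
  proof -
    have "(\<Prod>s\<in>{Suc r<..<Suc m}. y (Suc r) - y s) = (\<Prod>s\<in>{r<..<m}. y (Suc r) - y (Suc s))" for r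
      by (rule prod.reindex_bij_witness[of _ Suc "\<lambda>s. s - 1"]) auto
    moreover have "{0<..<Suc m} = {0<..m}" by auto
    ultimately show ?thesis by (simp add: prod.lessThan_Suc_shift del: prod.lessThan_Suc)
  qed
  ultimately show ?case
    unfolding M_def[symmetric] by (simp add: c_def cof prod.lessThan_Suc_shift del: prod.lessThan_Suc)
qed

section \<open>The q-analogue of the Jacobi-Trudi determinant\<close>

definition q_fact :: "complex \<Rightarrow> nat \<Rightarrow> complex" where
  "q_fact q k = (\<Prod>j=1..k. 1 - q ^ j)"

lemma q_fact_0 [simp]: "q_fact q 0 = 1"
  and q_fact_Suc: "q_fact q (Suc k) = q_fact q k * (1 - q ^ Suc k)"
  by (simp_all add: q_fact_def)

lemma one_minus_power_nonzero:
  assumes "norm (q :: complex) < 1" "k > 0" shows "1 - q ^ k \<noteq> 0"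
proof
  assume "1 - q ^ k = 0"
  then have "norm q ^ k = 1" by (metis eq_iff_diff_eq_0 norm_one norm_power)
  moreover have "norm q ^ k < 1" using assms by (intro power_less_one_iff[THEN iffD2]) auto
  ultimately show False by simp
qed

lemma q_fact_nonzero: "norm q < 1 \<Longrightarrow> q_fact q k \<noteq> 0"
  using one_minus_power_nonzero by (auto simp: q_fact_def)

text \<open>
  The exponent \<open>a + j - r\<close> is the one of the Jacobi-Trudi determinant; \<open>1 / (q)_k\<close> plays the role
  of the complete homogeneous function of degree \<open>k\<close>, which is zero for negative \<open>k\<close>.  In
  \<open>jt_det q i\<close> the rows above row \<open>i\<close> carry an additional factor \<open>q\<close> to the exponent.  Moving
  \<open>i\<close> from \<open>0\<close> to the number of rows interpolates between the plain determinant and its multiple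
  by \<open>q\<close> to the size of the shape.
\<close>

definition jt_entry :: "complex \<Rightarrow> bool \<Rightarrow> nat \<Rightarrow> nat \<Rightarrow> nat \<Rightarrow> complex" where
  "jt_entry q scaled a r j =
     (if r \<le> a + j then (if scaled then q ^ (a + j - r) else 1) / q_fact q (a + j - r) else 0)"

definition jt_det :: "complex \<Rightarrow> nat \<Rightarrow> nat list \<Rightarrow> complex" where
  "jt_det q i lam = det (mat (length lam) (length lam) (\<lambda>(r, j). jt_entry q (r < i) (lam ! r) r j))"

definition removable :: "nat list \<Rightarrow> nat \<Rightarrow> bool" where
  "removable lam i \<longleftrightarrow> i < length lam \<and> lam ! i > 0 \<and> (Suc i < length lam \<longrightarrow> lam ! Suc i < lam ! i)"

lemma jt_entry_diff:
  assumes "norm q < 1"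
  shows "jt_entry q False a i j - jt_entry q True a i j = jt_entry q False a (Suc i) j"
proof (cases "i < a + j")
  case True
  then obtain k where k: "a + j = i + Suc k" using less_imp_Suc_add by auto
  have "1 / q_fact q (Suc k) - q ^ Suc k / q_fact q (Suc k) = 1 / q_fact q k"
    using q_fact_nonzero[OF assms, of k] one_minus_power_nonzero[OF assms, of "Suc k"]
    by (simp add: q_fact_Suc divide_simps)
  then show ?thesis by (simp add: jt_entry_def k)
qed (auto simp: jt_entry_def)

text \<open>
  The two determinants differ in row \<open>i\<close> only, and the difference of these rows is the row that
  belongs to a part smaller by one.  If the last cell of row \<open>i\<close> is not removable, that row
  coincides with the next one or, in the last row, is zero.
\<close>

lemma jt_det_diff:
  assumes q: "norm q < 1" and i: "i < length lam" and sorted: "sorted_wrt (\<ge>) lam"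
  shows "jt_det q i lam - jt_det q (Suc i) lam =
    (if removable lam i then jt_det q i (lam[i := lam ! i - 1]) else 0)"
proof -
  let ?m = "length lam"
  define E where "E v = det (mat ?m ?m (\<lambda>(r, j). if r = i then v j else jt_entry q (r < i) (lam ! r) r j))" for v
  have "jt_det q i lam = E (jt_entry q False (lam ! i) i)"
    unfolding jt_det_def E_def by (intro arg_cong[where f = det] eq_matI) auto
  moreover have "jt_det q (Suc i) lam = E (jt_entry q True (lam ! i) i)"
    unfolding jt_det_def E_def by (intro arg_cong[where f = det] eq_matI) (auto simp: less_Suc_eq)
  ultimately have diff: "jt_det q i lam - jt_det q (Suc i) lam = E (jt_entry q False (lam ! i) (Suc i))"
    unfolding E_def by (simp only: det_row_linear[OF i jt_entry_diff[OF q]])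
  show ?thesis
  proof (cases "removable lam i")
    case True
    have "jt_entry q False (lam ! i) (Suc i) j = jt_entry q False (lam ! i - 1) i j" for j
      using True by (auto simp: jt_entry_def removable_def)
    then have "E (jt_entry q False (lam ! i) (Suc i)) = jt_det q i (lam[i := lam ! i - 1])"
      unfolding jt_det_def E_def using i by (intro arg_cong[where f = det] eq_matI) auto
    then show ?thesis using True diff by simp
  next
    case False
    have "E (jt_entry q False (lam ! i) (Suc i)) = 0"
    proof (cases "Suc i < ?m")
      case True
      then have "lam ! Suc i \<le> lam ! i" using sorted by (simp add: sorted_wrt_iff_nth_less)
      then have eq: "lam ! Suc i = lam ! i" using False True by (auto simp: removable_def)
      show ?thesis unfolding E_def
        by (rule det_identical_rows[of _ ?m i "Suc i"]) (use True eq in \<open>auto intro!: eq_vecI\<close>)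
    next
      case last: False
      then have z: "lam ! i = 0" "?m = Suc i" using False i by (auto simp: removable_def)
      let ?M = "mat ?m ?m (\<lambda>(r, j). if r = i then jt_entry q False (lam ! i) (Suc i) j else jt_entry q (r < i) (lam ! r) r j)"
      have "det ?M = (\<Sum>j<?m. ?M $$ (i, j) * cofactor ?M i j)"
        by (rule laplace_expansion_row) (use i in auto)
      also have "\<dots> = 0" by (rule sum.neutral) (use z in \<open>auto simp: jt_entry_def\<close>)
      finally show ?thesis by (simp add: E_def)
    qed
    then show ?thesis using False diff by simp
  qed
qed

text \<open>
  In the expansion over permutations, the exponents in each nonzero term add up to the size of
  the shape.
\<close>

lemma jt_det_all_scaled:
  "jt_det q (length lam) lam = q ^ sum_list lam * jt_det q 0 lam"
proof -
  let ?m = "length lam"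
  define M where "M s = mat ?m ?m (\<lambda>(r, j). jt_entry q s (lam ! r) r j)" for s
  have M: "M s \<in> carrier_mat ?m ?m" for s by (simp add: M_def)
  have "jt_det q ?m lam = det (M True)"
    unfolding jt_det_def M_def by (intro arg_cong[where f = det] eq_matI) auto
  also have "\<dots> = (\<Sum>p\<in>{p. p permutes {0..<?m}}. signof p * (\<Prod>r=0..<?m. M True $$ (r, p r)))"
    by (rule det_def'[OF M])
  also have "\<dots> = (\<Sum>p\<in>{p. p permutes {0..<?m}}. q ^ sum_list lam * (signof p * (\<Prod>r=0..<?m. M False $$ (r, p r))))"
  proof (rule sum.cong[OF refl], clarify)
    fix p assume p: "p permutes {0..<?m}"
    have pr: "p r < ?m" if "r < ?m" for r using permutes_in_image[OF p, of r] that by simp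
    have "(\<Prod>r=0..<?m. M True $$ (r, p r)) = q ^ sum_list lam * (\<Prod>r=0..<?m. M False $$ (r, p r))"
    proof (cases "\<forall>r<?m. r \<le> lam ! r + p r")
      case True
      have "(\<Prod>r=0..<?m. M True $$ (r, p r)) = (\<Prod>r=0..<?m. q ^ (lam ! r + p r - r) * M False $$ (r, p r))"
        by (rule prod.cong) (auto simp: M_def pr jt_entry_def)
      also have "\<dots> = q ^ (\<Sum>r=0..<?m. lam ! r + p r - r) * (\<Prod>r=0..<?m. M False $$ (r, p r))"
        by (simp add: prod.distrib power_sum)
      also have "(\<Sum>r=0..<?m. lam ! r + p r - r) = (\<Sum>r=0..<?m. lam ! r + p r) - (\<Sum>r=0..<?m. r)"
        by (rule sum_subtractf_nat) (use True in auto)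
      also have "(\<Sum>r=0..<?m. lam ! r + p r) = sum_list lam + (\<Sum>r=0..<?m. r)"
        using sum.permute[OF p, of id] by (simp add: sum.distrib sum_list_sum_nth comp_def)
      finally show ?thesis by simp
    next
      case False
      then obtain r where r: "r < ?m" "\<not> r \<le> lam ! r + p r" by auto
      have zero: "(\<Prod>r=0..<?m. M s $$ (r, p r)) = 0" for s
        by (rule prod_zero) (use r pr in \<open>auto intro!: bexI[of _ r] simp: M_def jt_entry_def\<close>)
      show ?thesis unfolding zero by simp
    qed
    then show "signof p * (\<Prod>r=0..<?m. M True $$ (r, p r)) = q ^ sum_list lam * (signof p * (\<Prod>r=0..<?m. M False $$ (r, p r)))"
      by simp
  qed
  also have "\<dots> = q ^ sum_list lam * det (M False)"
    unfolding det_def'[OF M] by (simp add: sum_distrib_left)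
  also have "det (M False) = jt_det q 0 lam"
    unfolding jt_det_def M_def by (intro arg_cong[where f = det] eq_matI) auto
  finally show ?thesis .
qed

lemma jt_det_empty_shape:
  assumes "sum_list lam = 0"
  shows "jt_det q i lam = 1"
proof -
  let ?m = "length lam"
  let ?M = "mat ?m ?m (\<lambda>(r, j). jt_entry q (r < i) (lam ! r) r j)"
  have z: "lam ! r = 0" if "r < ?m" for r using assms that by (auto simp: sum_list_eq_0_iff)
  have "det ?M = prod_list (diag_mat ?M)"
    by (rule det_upper_triangular[of _ ?m]) (auto simp: upper_triangular_def jt_entry_def z)
  also have "diag_mat ?M = replicate ?m 1"
    by (rule nth_equalityI) (auto simp: diag_mat_def jt_entry_def z)
  finally show ?thesis by (simp add: jt_det_def)
qed

text \<open>
  The entry in row \<open>r\<close> and column \<open>j\<close> is \<open>1 / (q)_(beta r)\<close> times a polynomial of degree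
  \<open>m - 1 - j\<close> in \<open>q^(beta r)\<close>, so the determinant is a generalized Vandermonde determinant.  The
  power of \<open>norm q\<close> on the left is the reciprocal of the modulus of the product of the leading coefficients.
\<close>

lemma jt_det_product:
  fixes lam :: "nat list"
  assumes q: "norm q < 1" "q \<noteq> 0" and sorted: "sorted_wrt (\<ge>) lam"
  defines "m \<equiv> length lam"
  defines "beta \<equiv> \<lambda>r. lam ! r + (m - Suc r)"
  shows "norm (jt_det q 0 lam) * norm q ^ (\<Sum>c<m. \<Sum>{..<c}) * (\<Prod>r<m. norm (q_fact q (beta r))) =
     (\<Prod>r<m. \<Prod>s\<in>{r<..<m}. norm (q ^ beta r - q ^ beta s))"
proof -
  define P where "P c = (\<Prod>k<c. [:1, - inverse (q ^ k):])" for c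
  have anti: "beta s < beta r" if "r < s" "s < m" for r s
  proof -
    have "lam ! s \<le> lam ! r" using sorted that by (auto simp: sorted_wrt_iff_nth_less m_def)
    then show ?thesis using that by (simp add: beta_def)
  qed
  have inj: "inj_on (\<lambda>r. q ^ beta r) {..<m}"
  proof (rule inj_onI, rule ccontr)
    fix r s assume rs: "r \<in> {..<m}" "s \<in> {..<m}" "q ^ beta r = q ^ beta s" "r \<noteq> s"
    then have ne: "beta r \<noteq> beta s" using anti[of r s] anti[of s r] by (cases "r < s") auto
    have "norm q ^ beta r = norm q ^ beta s" using rs(3) by (metis norm_power)
    then show False using q ne power_inject_exp'[of "norm q"] by auto
  qed
  have entry: "jt_entry q False (lam ! r) r j = inverse (q_fact q (beta r)) * poly (P (m - Suc j)) (q ^ beta r)"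
    if "r < m" "j < m" for r j
  proof -
    define c where "c = m - Suc j"
    have bc: "r \<le> lam ! r + j \<longleftrightarrow> c \<le> beta r" "lam ! r + j - r = beta r - c"
      using that by (auto simp: beta_def c_def)
    have fac: "poly (P c) (q ^ l) = (if c \<le> l then q_fact q l / q_fact q (l - c) else 0)" for l
    proof (induction c)
      case 0
      then show ?case using q_fact_nonzero[OF q(1)] by (simp add: P_def)
    next
      case (Suc c)
      have PS: "poly (P (Suc c)) (q ^ l) = poly (P c) (q ^ l) * (1 - q ^ l / q ^ c)"
        by (simp add: P_def) (simp add: divide_inverse algebra_simps)
      show ?case
      proof (cases "Suc c \<le> l")
        case True
        then obtain k where k: "l = c + Suc k" by (metis Suc_le_eq less_imp_Suc_add add_Suc_right)
        have "q ^ l / q ^ c = q ^ Suc k" using q(2) by (simp add: k power_add)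
        moreover have "q_fact q (l - c) = q_fact q (l - Suc c) * (1 - q ^ Suc k)"
          by (simp add: k q_fact_Suc)
        moreover have "1 - q ^ Suc k \<noteq> 0" by (rule one_minus_power_nonzero[OF q(1)]) simp
        ultimately show ?thesis
          using True unfolding PS Suc.IH by simp
      next
        case False
        then show ?thesis unfolding PS Suc.IH using q(2) by (cases "c = l") auto
      qed
    qed
    show ?thesis
      unfolding c_def[symmetric] fac jt_entry_def bc using q_fact_nonzero[OF q(1)] by (simp add: field_simps)
  qed
  define V where "V = mat m m (\<lambda>(r, j). poly (P (m - Suc j)) (q ^ beta r))"
  have "jt_det q 0 lam = det (mat\<^sub>r m m (\<lambda>r. inverse (q_fact q (beta r)) \<cdot>\<^sub>v row V r))"
    unfolding jt_det_def m_def[symmetric] by (intro arg_cong[where f = det] eq_matI) (auto simp: entry V_def)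
  also have "\<dots> = (\<Prod>r=0..<m. inverse (q_fact q (beta r))) * det (mat\<^sub>r m m (row V))"
    by (rule det_rows_mul) (auto simp: V_def)
  also have "mat\<^sub>r m m (row V) = V" by (intro eq_matI) (auto simp: V_def)
  also have "det V = (\<Prod>j<m. coeff (P (m - Suc j)) (m - Suc j)) * (\<Prod>r<m. \<Prod>s\<in>{r<..<m}. q ^ beta r - q ^ beta s)"
    unfolding V_def
  proof (rule det_generalized_Vandermonde[OF _ inj])
    show "degree (P (m - Suc j)) \<le> m - Suc j" for j
      unfolding P_def by (rule order.trans[OF degree_prod_sum_le]) (auto intro!: order.trans[OF sum_bounded_above[of _ _ 1]])
  qed
  also have "(\<Prod>j<m. coeff (P (m - Suc j)) (m - Suc j)) = (\<Prod>c<m. \<Prod>k<c. - inverse (q ^ k))"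
  proof -
    have "coeff (P c) c = (\<Prod>k<c. - inverse (q ^ k))" for c
    proof -
      have "degree (P c) = c" unfolding P_def using q(2) by (subst degree_prod_eq_sum_degree) auto
      then have "coeff (P c) c = lead_coeff (P c)" by simp
      also have "\<dots> = (\<Prod>k<c. lead_coeff [:1, - inverse (q ^ k):])" unfolding P_def by (rule lead_coeff_prod)
      also have "\<dots> = (\<Prod>k<c. - inverse (q ^ k))" using q(2) by simp
      finally show ?thesis .
    qed
    then show ?thesis using prod.nat_diff_reindex[of "\<lambda>c. \<Prod>k<c. - inverse (q ^ k)" m] by simp
  qed
  finally have "jt_det q 0 lam = (\<Prod>r<m. inverse (q_fact q (beta r))) * ((\<Prod>c<m. \<Prod>k<c. - inverse (q ^ k)) *
     (\<Prod>r<m. \<Prod>s\<in>{r<..<m}. q ^ beta r - q ^ beta s))" by (simp add: atLeast0LessThan)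
  moreover have n: "norm (\<Prod>r<m. inverse (q_fact q (beta r))) = inverse (\<Prod>r<m. norm (q_fact q (beta r)))"
    "norm (\<Prod>c<m. \<Prod>k<c. - inverse (q ^ k)) = inverse (norm q ^ (\<Sum>c<m. \<Sum>{..<c}))"
    "norm (\<Prod>r<m. \<Prod>s\<in>{r<..<m}. q ^ beta r - q ^ beta s) = (\<Prod>r<m. \<Prod>s\<in>{r<..<m}. norm (q ^ beta r - q ^ beta s))"
    by (simp_all add: prod_norm[symmetric] norm_inverse norm_power prod_inversef[symmetric] comp_def power_sum)
  ultimately have "norm (jt_det q 0 lam) = inverse (\<Prod>r<m. norm (q_fact q (beta r))) * (inverse (norm q ^ (\<Sum>c<m. \<Sum>{..<c})) *
     (\<Prod>r<m. \<Prod>s\<in>{r<..<m}. norm (q ^ beta r - q ^ beta s)))"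
    by (simp only: norm_mult n)
  moreover have "(\<Prod>r<m. norm (q_fact q (beta r))) \<noteq> 0" using q_fact_nonzero[OF q(1)] by simp
  moreover have "norm q ^ (\<Sum>c<m. \<Sum>{..<c}) \<noteq> 0" using q(2) by simp
  ultimately show ?thesis by (simp add: field_simps)
qed

section \<open>Removing the largest entry of a standard tableau\<close>

lemma card_diagram: "card (diagram lam) = sum_list lam"
proof -
  have "diagram lam = (SIGMA i:{..<length lam}. {..<lam ! i})"
    by (auto simp: diagram_def)
  then show ?thesis by (simp add: sum_list_sum_nth atLeast0LessThan)
qed

lemma SYT_row_less:
  "T \<in> SYT lam \<Longrightarrow> (i, j) \<in> diagram lam \<Longrightarrow> (i, j') \<in> diagram lam \<Longrightarrow> j < j' \<Longrightarrow> T (i, j) < T (i, j')"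
  unfolding SYT_def by blast

lemma SYT_column_less:
  "T \<in> SYT lam \<Longrightarrow> (i, j) \<in> diagram lam \<Longrightarrow> (i', j) \<in> diagram lam \<Longrightarrow> i < i' \<Longrightarrow> T (i, j) < T (i', j)"
  unfolding SYT_def by blast

text \<open>
  The tableaux whose largest entry lies in row \<open>i\<close>, where it necessarily occupies the last cell.
\<close>

definition SYT_row :: "nat list \<Rightarrow> nat \<Rightarrow> (nat \<times> nat \<Rightarrow> nat) set" where
  "SYT_row lam i = {T \<in> SYT lam. removable lam i \<and> T (i, lam ! i - 1) = sum_list lam}"

lemma SYT_max_cell:
  assumes T: "T \<in> SYT lam" and ij: "(i, j) \<in> diagram lam" "T (i, j) = sum_list lam"
    and sorted: "sorted_wrt (\<ge>) lam"
  shows "j = lam ! i - 1" "removable lam i" "T \<in> SYT_row lam i"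
proof -
  have le: "T c \<le> sum_list lam" if "c \<in> diagram lam" for c
    using T that by (auto simp: SYT_def dest!: bij_betwE)
  have i: "i < length lam" "j < lam ! i" using ij by (auto simp: diagram_def)
  show j: "j = lam ! i - 1"
  proof (rule ccontr)
    assume "j \<noteq> lam ! i - 1"
    then have c: "(i, lam ! i - 1) \<in> diagram lam" "j < lam ! i - 1" using i by (auto simp: diagram_def)
    then have "T (i, j) < T (i, lam ! i - 1)" using SYT_row_less[OF T ij(1)] by simp
    then show False using le[OF c(1)] ij by simp
  qed
  show rem: "removable lam i"
  proof (rule ccontr)
    assume "\<not> removable lam i"
    then have *: "Suc i < length lam" "lam ! i \<le> lam ! Suc i" using i by (auto simp: removable_def)
    then have c: "(Suc i, j) \<in> diagram lam" using i by (auto simp: diagram_def)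
    moreover have "i < Suc i" by simp
    ultimately have "T (i, j) < T (Suc i, j)" using SYT_column_less[OF T ij(1)] by simp
    then show False using le[OF c] ij by simp
  qed
  show "T \<in> SYT_row lam i" using T rem ij j by (simp add: SYT_row_def)
qed

lemma SYT_row_disjoint:
  assumes "T \<in> SYT_row lam i" "T \<in> SYT_row lam i'"
  shows "i = i'"
proof -
  have inj: "inj_on T (diagram lam)" using assms by (auto simp: SYT_row_def SYT_def bij_betw_def)
  have "(i, lam ! i - 1) \<in> diagram lam" "(i', lam ! i' - 1) \<in> diagram lam"
    using assms by (auto simp: SYT_row_def removable_def diagram_def)
  then have "(i, lam ! i - 1) = (i', lam ! i' - 1)"
    using inj assms by (intro inj_onD[OF inj]) (auto simp: SYT_row_def)
  then show ?thesis by simp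
qed

lemma SYT_eq_Union_SYT_row:
  assumes "sorted_wrt (\<ge>) lam" "sum_list lam > 0"
  shows "SYT lam = (\<Union>i<length lam. SYT_row lam i)"
proof (intro equalityI subsetI)
  fix T assume T: "T \<in> SYT lam"
  then have "sum_list lam \<in> T ` diagram lam" using assms(2) by (auto simp: SYT_def bij_betw_def)
  then obtain i j where ij: "(i, j) \<in> diagram lam" "T (i, j) = sum_list lam" by auto
  then have "T \<in> SYT_row lam i" by (rule SYT_max_cell[OF T _ _ assms(1)])
  moreover have "i < length lam" using ij by (auto simp: diagram_def)
  ultimately show "T \<in> (\<Union>i<length lam. SYT_row lam i)" by auto
qed (auto simp: SYT_row_def)

context
  fixes lam lam' :: "nat list" and i :: nat and c :: "nat \<times> nat"
  assumes sorted: "sorted_wrt (\<ge>) lam" and rem: "removable lam i"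
  defines "lam' \<equiv> lam[i := lam ! i - 1]" and "c \<equiv> (i, lam ! i - 1)"
begin

lemma removable_nth_less: "i < i' \<Longrightarrow> i' < length lam \<Longrightarrow> lam ! i' < lam ! i"
proof -
  assume a: "i < i'" "i' < length lam"
  then have "lam ! i' \<le> lam ! Suc i"
    using sorted by (cases "i' = Suc i") (auto simp: sorted_wrt_iff_nth_less)
  then show ?thesis using rem a by (auto simp: removable_def)
qed

lemma sorted_remove: "sorted_wrt (\<ge>) lam'"
  unfolding sorted_wrt_iff_nth_less
proof (intro allI impI)
  fix a b assume ab: "a < b" "b < length lam'"
  then have le: "lam ! b \<le> lam ! a" using sorted by (auto simp: sorted_wrt_iff_nth_less lam'_def)
  show "lam' ! b \<le> lam' ! a"
  proof (cases "a = i")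
    case True
    then show ?thesis using removable_nth_less[of b] ab by (auto simp: lam'_def)
  next
    case False
    then show ?thesis using le ab by (cases "b = i") (auto simp: lam'_def)
  qed
qed

lemma diagram_remove: "diagram lam = insert c (diagram lam')" "c \<notin> diagram lam'"
  using rem by (auto simp: diagram_def lam'_def c_def removable_def nth_list_update split: if_splits)

lemma sum_list_remove: "sum_list lam = Suc (sum_list lam')"
  using card_diagram[of lam] card_diagram[of lam'] diagram_remove finite_diagram[of lam'] by simp

lemma SYT_extend:
  assumes T: "T \<in> SYT lam'"
  shows "T(c := sum_list lam) \<in> SYT_row lam i"
proof -
  let ?T = "T(c := sum_list lam)"
  have bij: "bij_betw T (diagram lam') {1..sum_list lam'}" using T by (simp add: SYT_def)
  have le: "T x < sum_list lam" if "x \<in> diagram lam'" for x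
    using bij_betwE[OF bij] that by (force simp: sum_list_remove)
  have "bij_betw ?T (diagram lam) {1..sum_list lam}"
  proof -
    have "bij_betw ?T (diagram lam') {1..sum_list lam'}"
      using bij diagram_remove(2) by (subst bij_betw_cong[of _ _ T]) auto
    then have "bij_betw ?T (insert c (diagram lam')) (insert (?T c) {1..sum_list lam'})"
      using diagram_remove(2) by (subst notIn_Un_bij_betw3[of c, simplified, symmetric]) (auto simp: sum_list_remove)
    moreover have "insert (?T c) {1..sum_list lam'} = {1..sum_list lam}" by (auto simp: sum_list_remove)
    ultimately show ?thesis by (simp only: diagram_remove(1))
  qed
  moreover have "?T \<in> extensional (diagram lam)"
    using T by (auto simp: SYT_def extensional_def diagram_remove(1))
  moreover have "?T (a, b) < ?T (a, b')" if "(a, b) \<in> diagram lam" "(a, b') \<in> diagram lam" "b < b'" for a b b'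
  proof -
    have ne: "(a, b) \<noteq> c" using that by (auto simp: c_def diagram_def)
    show ?thesis
    proof (cases "(a, b') = c")
      case True
      then show ?thesis using ne le that diagram_remove(1) by auto
    next
      case False
      then have "(a, b) \<in> diagram lam'" "(a, b') \<in> diagram lam'" using ne that diagram_remove(1) by auto
      then show ?thesis using SYT_row_less[OF T _ _ that(3)] ne False by simp
    qed
  qed
  moreover have "?T (a, b) < ?T (a', b)" if "(a, b) \<in> diagram lam" "(a', b) \<in> diagram lam" "a < a'" for a a' b
  proof -
    have ne: "(a, b) \<noteq> c"
      using that removable_nth_less[of a'] by (auto simp: c_def diagram_def)
    show ?thesis
    proof (cases "(a', b) = c")
      case True
      then show ?thesis using ne le that diagram_remove(1) by auto
    next
      case False
      then have "(a, b) \<in> diagram lam'" "(a', b) \<in> diagram lam'" using ne that diagram_remove(1) by auto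
      then show ?thesis using SYT_column_less[OF T _ _ that(3)] ne False by simp
    qed
  qed
  ultimately have "?T \<in> SYT lam" unfolding SYT_def by blast
  then show ?thesis using rem by (simp add: SYT_row_def c_def)
qed

lemma SYT_restrict:
  assumes T: "T \<in> SYT_row lam i"
  shows "T(c := undefined) \<in> SYT lam'"
proof -
  let ?T = "T(c := undefined)"
  have Tc: "T c = sum_list lam" and TS: "T \<in> SYT lam" using T by (auto simp: SYT_row_def c_def)
  have "bij_betw T (diagram lam - {c}) ({1..sum_list lam} - {sum_list lam})"
    using TS diagram_remove Tc by (intro bij_betw_DiffI) (auto simp: SYT_def sum_list_remove)
  moreover have "diagram lam - {c} = diagram lam'" using diagram_remove by auto
  moreover have "{1..sum_list lam} - {sum_list lam} = {1..sum_list lam'}" by (auto simp: sum_list_remove)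
  ultimately have "bij_betw T (diagram lam') {1..sum_list lam'}" by simp
  then have "bij_betw ?T (diagram lam') {1..sum_list lam'}"
    using diagram_remove(2) by (subst bij_betw_cong[of _ _ T]) auto
  moreover have "?T \<in> extensional (diagram lam')"
    using TS by (auto simp: SYT_def extensional_def diagram_remove(1))
  moreover have Tx: "?T x = T x" "x \<in> diagram lam" if "x \<in> diagram lam'" for x
    using diagram_remove that by auto
  have "?T (a, b) < ?T (a, b')" if "(a, b) \<in> diagram lam'" "(a, b') \<in> diagram lam'" "b < b'" for a b b'
    unfolding Tx(1)[OF that(1)] Tx(1)[OF that(2)] by (rule SYT_row_less[OF TS Tx(2) Tx(2)]) (use that in auto)
  moreover have "?T (a, b) < ?T (a', b)" if "(a, b) \<in> diagram lam'" "(a', b) \<in> diagram lam'" "a < a'" for a a' b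
    unfolding Tx(1)[OF that(1)] Tx(1)[OF that(2)] by (rule SYT_column_less[OF TS Tx(2) Tx(2)]) (use that in auto)
  ultimately show ?thesis unfolding SYT_def by blast
qed

lemma bij_betw_SYT_extend: "bij_betw (\<lambda>T. T(c := sum_list lam)) (SYT lam') (SYT_row lam i)"
proof (rule bij_betw_byWitness[of _ "\<lambda>T. T(c := undefined)"])
  show "\<forall>T\<in>SYT lam'. (T(c := sum_list lam))(c := undefined) = T"
    using diagram_remove(2) by (auto simp: SYT_def extensional_def fun_eq_iff)
  show "\<forall>T\<in>SYT_row lam i. (T(c := undefined))(c := sum_list lam) = T"
    by (auto simp: SYT_row_def c_def fun_eq_iff)
qed (use SYT_extend SYT_restrict in auto)

text \<open>
  The entry \<open>sum_list lam'\<close> becomes a descent exactly if it lies in a row above the cell that is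
  added.
\<close>

lemma maj_extend:
  assumes T: "T \<in> SYT lam'"
  shows "maj lam (T(c := sum_list lam)) =
    maj lam' T + (if \<exists>r<i. T \<in> SYT_row lam' r then sum_list lam' else 0)"
proof -
  let ?T = "T(c := sum_list lam)" and ?n = "sum_list lam'"
  have bij: "bij_betw T (diagram lam') {1..?n}" using T by (simp add: SYT_def)
  have le: "T x \<le> ?n" "1 \<le> T x" if "x \<in> diagram lam'" for x
    using bij_betwE[OF bij] that by force+
  have Tx: "?T x = T x" if "x \<in> diagram lam'" for x using diagram_remove(2) that by auto
  have Tc: "?T c = Suc ?n" by (simp add: sum_list_remove)
  have row: "(\<exists>r<i. T \<in> SYT_row lam' r) \<longleftrightarrow> (\<exists>r j. r < i \<and> (r, j) \<in> diagram lam' \<and> T (r, j) = ?n)"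
  proof
    assume "\<exists>r<i. T \<in> SYT_row lam' r"
    then obtain r where r: "r < i" "T \<in> SYT_row lam' r" by auto
    then have "(r, lam' ! r - 1) \<in> diagram lam'" "T (r, lam' ! r - 1) = ?n"
      by (auto simp: SYT_row_def removable_def diagram_def)
    then show "\<exists>r j. r < i \<and> (r, j) \<in> diagram lam' \<and> T (r, j) = ?n" using r by blast
  next
    assume "\<exists>r j. r < i \<and> (r, j) \<in> diagram lam' \<and> T (r, j) = ?n"
    then show "\<exists>r<i. T \<in> SYT_row lam' r" using SYT_max_cell(3)[OF T _ _ sorted_remove] by blast
  qed
  have mem: "k \<in> descents lam ?T \<longleftrightarrow> k \<in> descents lam' T \<or> k = ?n \<and> (\<exists>r<i. T \<in> SYT_row lam' r)" for k
  proof (cases "k < ?n")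
    case True
    have "(\<exists>a b a' b'. (a, b) \<in> diagram lam \<and> (a', b') \<in> diagram lam \<and> ?T (a, b) = k \<and> ?T (a', b') = k + 1 \<and> a < a') \<longleftrightarrow>
      (\<exists>a b a' b'. (a, b) \<in> diagram lam' \<and> (a', b') \<in> diagram lam' \<and> T (a, b) = k \<and> T (a', b') = k + 1 \<and> a < a')" (is "?L \<longleftrightarrow> ?R")
    proof
      assume ?L
      then obtain a b a' b' where *: "(a, b) \<in> diagram lam" "(a', b') \<in> diagram lam" "?T (a, b) = k" "?T (a', b') = k + 1" "a < a'" by blast
      then have "(a, b) \<noteq> c" "(a', b') \<noteq> c" using True Tc by auto
      then have "(a, b) \<in> diagram lam'" "(a', b') \<in> diagram lam'" using * diagram_remove(1) by auto
      then show ?R using * Tx by metis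
    next
      assume ?R
      then obtain a b a' b' where *: "(a, b) \<in> diagram lam'" "(a', b') \<in> diagram lam'" "T (a, b) = k" "T (a', b') = k + 1" "a < a'" by blast
      then have "(a, b) \<in> diagram lam" "(a', b') \<in> diagram lam" using diagram_remove(1) by auto
      moreover have "?T (a, b) = k" "?T (a', b') = k + 1" using * by (simp_all only: Tx)
      ultimately show ?L using *(5) by blast
    qed
    then show ?thesis using True by (auto simp only: descents_def sum_list_remove mem_Collect_eq atLeastLessThan_iff)
  next
    case False
    show ?thesis
    proof (cases "k = ?n")
      case True
      have "(\<exists>a b a' b'. (a, b) \<in> diagram lam \<and> (a', b') \<in> diagram lam \<and> ?T (a, b) = ?n \<and> ?T (a', b') = ?n + 1 \<and> a < a') \<longleftrightarrow>
        (\<exists>r j. r < i \<and> (r, j) \<in> diagram lam' \<and> T (r, j) = ?n)" (is "?L \<longleftrightarrow> ?R")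
      proof
        assume ?L
        then obtain a b a' b' where *: "(a, b) \<in> diagram lam" "(a', b') \<in> diagram lam" "?T (a, b) = ?n" "?T (a', b') = ?n + 1" "a < a'" by blast
        then have "(a, b) \<noteq> c" using Tc by auto
        then have ab: "(a, b) \<in> diagram lam'" using * diagram_remove(1) by auto
        have "(a', b') = c"
        proof (rule ccontr)
          assume "(a', b') \<noteq> c"
          then have ab': "(a', b') \<in> diagram lam'" using * diagram_remove(1) by auto
          show False using le(1)[OF ab'] Tx[OF ab'] *(4) by linarith
        qed
        then have "a' = i" by (simp add: c_def)
        then show ?R using * ab Tx[OF ab] by metis
      next
        assume ?R
        then obtain r j where *: "r < i" "(r, j) \<in> diagram lam'" "T (r, j) = ?n" by blast
        have "(r, j) \<in> diagram lam" using *(2) diagram_remove(1) by auto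
        moreover have "?T (r, j) = ?n" by (rule trans[OF Tx[OF *(2)] *(3)])
        moreover have "c \<in> diagram lam" "?T c = ?n + 1" using diagram_remove(1) Tc by auto
        ultimately show ?L using *(1) unfolding c_def by blast
      qed
      moreover have "1 \<le> ?n" if ?R
        using that le(2) by (metis)
      ultimately show ?thesis using True row
        by (auto simp only: descents_def sum_list_remove mem_Collect_eq atLeastLessThan_iff)
    next
      case ne: False
      then show ?thesis using False by (auto simp: descents_def sum_list_remove)
    qed
  qed
  have "descents lam ?T = descents lam' T \<union> (if \<exists>r<i. T \<in> SYT_row lam' r then {?n} else {})"
    using mem by auto
  then have "maj lam ?T = \<Sum>(descents lam' T \<union> (if \<exists>r<i. T \<in> SYT_row lam' r then {?n} else {}))"
    by (simp only: maj_def)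
  also have "\<dots> = maj lam' T + \<Sum>(if \<exists>r<i. T \<in> SYT_row lam' r then {?n} else {})"
    unfolding maj_def by (rule sum.union_disjoint) (auto simp: descents_def)
  also have "\<Sum>(if \<exists>r<i. T \<in> SYT_row lam' r then {?n} else {}) = (if \<exists>r<i. T \<in> SYT_row lam' r then ?n else 0)"
    by (cases "\<exists>r<i. T \<in> SYT_row lam' r") (simp_all only: if_True if_False sum.empty, simp)
  finally show ?thesis .
qed

end

section \<open>The generating polynomial of the major index as a determinant\<close>

definition maj_poly :: "complex \<Rightarrow> nat list \<Rightarrow> complex" where
  "maj_poly q lam = (\<Sum>T\<in>SYT lam. q ^ maj lam T)"

definition maj_poly_row :: "complex \<Rightarrow> nat list \<Rightarrow> nat \<Rightarrow> complex" where
  "maj_poly_row q lam i = (\<Sum>T\<in>SYT_row lam i. q ^ maj lam T)"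

lemma sum_SYT_eq_sum_rows:
  fixes g :: "(nat \<times> nat \<Rightarrow> nat) \<Rightarrow> complex"
  assumes "sorted_wrt (\<ge>) lam" "sum_list lam > 0"
  shows "(\<Sum>T\<in>SYT lam. g T) = (\<Sum>i<length lam. \<Sum>T\<in>SYT_row lam i. g T)"
  unfolding SYT_eq_Union_SYT_row[OF assms]
proof (rule sum.UNION_disjoint)
  show "\<forall>i\<in>{..<length lam}. finite (SYT_row lam i)"
    by (auto simp: SYT_row_def finite_SYT)
  show "\<forall>i\<in>{..<length lam}. \<forall>j\<in>{..<length lam}. i \<noteq> j \<longrightarrow> SYT_row lam i \<inter> SYT_row lam j = {}"
    using SYT_row_disjoint by blast
qed simp

lemma maj_poly_eq_sum_rows:
  assumes "sorted_wrt (\<ge>) lam" "sum_list lam > 0"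
  shows "maj_poly q lam = (\<Sum>i<length lam. maj_poly_row q lam i)"
  unfolding maj_poly_def maj_poly_row_def by (rule sum_SYT_eq_sum_rows[OF assms])

text \<open>
  Adding a cell in row \<open>i\<close> contributes \<open>q ^ sum_list lam'\<close> if the largest entry of the smaller
  tableau lies above row \<open>i\<close>, and \<open>1\<close> otherwise.
\<close>

lemma maj_poly_row_remove:
  assumes sorted: "sorted_wrt (\<ge>) lam" and rem: "removable lam i"
  defines "lam' \<equiv> lam[i := lam ! i - 1]"
  shows "maj_poly_row q lam i = q ^ sum_list lam' * maj_poly q lam'
    + (1 - q ^ sum_list lam') * (\<Sum>r=i..<length lam. maj_poly_row q lam' r)"
proof -
  let ?n = "sum_list lam'" and ?c = "(i, lam ! i - 1)" and ?m = "length lam"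
  define D where "D T \<longleftrightarrow> (\<exists>r<i. T \<in> SYT_row lam' r)" for T
  have i: "i < ?m" using rem by (simp add: removable_def)
  have len: "length lam' = ?m" by (simp add: lam'_def)
  have sorted': "sorted_wrt (\<ge>) lam'" unfolding lam'_def by (rule sorted_remove[OF sorted rem])
  have "maj_poly_row q lam i = (\<Sum>T\<in>SYT lam'. q ^ maj lam (T(?c := sum_list lam)))"
    unfolding maj_poly_row_def lam'_def
    by (rule sum.reindex_bij_betw[OF bij_betw_SYT_extend[OF sorted rem], symmetric])
  also have "\<dots> = (\<Sum>T\<in>SYT lam'. q ^ maj lam' T * (if D T then q ^ ?n else 1))"
  proof (rule sum.cong[OF refl])
    fix T assume T: "T \<in> SYT lam'"
    have "maj lam (T(?c := sum_list lam)) = maj lam' T + (if D T then ?n else 0)"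
      unfolding D_def lam'_def by (rule maj_extend[OF sorted rem]) (use T in \<open>simp only: lam'_def\<close>)
    then show "q ^ maj lam (T(?c := sum_list lam)) = q ^ maj lam' T * (if D T then q ^ ?n else 1)"
      by (simp only: power_add if_distrib[of "power q"] power_0)
  qed
  also have "\<dots> = q ^ ?n * maj_poly q lam' + (1 - q ^ ?n) * (\<Sum>r=i..<?m. maj_poly_row q lam' r)"
  proof (cases "?n = 0")
    case True
    then have pn: "q ^ ?n = 1" by (metis power_0)
    show ?thesis unfolding pn maj_poly_def by simp
  next
    case False
    then have pos: "0 < ?n" by (rule neq0_conv[THEN iffD1])
    have "(\<Sum>T\<in>SYT lam'. q ^ maj lam' T * (if D T then q ^ ?n else 1)) =
      (\<Sum>r<?m. \<Sum>T\<in>SYT_row lam' r. q ^ maj lam' T * (if D T then q ^ ?n else 1))"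
      unfolding len[symmetric] by (rule sum_SYT_eq_sum_rows[OF sorted' pos])
    also have "\<dots> = (\<Sum>r<?m. (if r < i then q ^ ?n else 1) * maj_poly_row q lam' r)"
    proof (rule sum.cong[OF refl])
      fix r
      have D: "D T \<longleftrightarrow> r < i" if "T \<in> SYT_row lam' r" for T
        unfolding D_def using that SYT_row_disjoint by metis
      have "(\<Sum>T\<in>SYT_row lam' r. q ^ maj lam' T * (if D T then q ^ ?n else 1)) =
        (\<Sum>T\<in>SYT_row lam' r. (if r < i then q ^ ?n else 1) * q ^ maj lam' T)"
        by (rule sum.cong) (auto simp: D)
      then show "(\<Sum>T\<in>SYT_row lam' r. q ^ maj lam' T * (if D T then q ^ ?n else 1)) =
         (if r < i then q ^ ?n else 1) * maj_poly_row q lam' r"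
        by (simp only: maj_poly_row_def sum_distrib_left)
    qed
    also have "\<dots> = (\<Sum>r<?m. q ^ ?n * maj_poly_row q lam' r + (if r < i then 0 else (1 - q ^ ?n) * maj_poly_row q lam' r))"
      by (rule sum.cong) (auto simp: algebra_simps)
    also have "\<dots> = q ^ ?n * maj_poly q lam' + (\<Sum>r<?m. if r < i then 0 else (1 - q ^ ?n) * maj_poly_row q lam' r)"
      unfolding maj_poly_eq_sum_rows[OF sorted' pos] len by (simp only: sum.distrib sum_distrib_left)
    also have "(\<Sum>r<?m. if r < i then 0 else (1 - q ^ ?n) * maj_poly_row q lam' r) = (\<Sum>r=i..<?m. (1 - q ^ ?n) * maj_poly_row q lam' r)"
      by (rule sum.mono_neutral_cong_right) auto
    finally show ?thesis by (simp add: sum_distrib_left)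
  qed
  finally show ?thesis .
qed

lemma SYT_empty_shape:
  assumes "sum_list lam = 0"
  shows "SYT lam = {\<lambda>_. undefined}"
proof -
  have "diagram lam = {}" using card_diagram[of lam] finite_diagram[of lam] assms by simp
  then show ?thesis using assms by (auto simp: SYT_def bij_betw_def)
qed

text \<open>
  The right-hand side interpolates between \<open>maj_poly q lam\<close> at \<open>i = 0\<close> and its multiple by
  \<open>q ^ sum_list lam\<close> at \<open>i = length lam\<close>, like the determinants do.  It is also what
  \<open>maj_poly_row_remove\<close> yields for the shape without the last cell of row \<open>i\<close>.  Hence the
  induction hypothesis says that \<open>maj_poly_row q lam i\<close> is a multiple of
  \<open>jt_det q i lam - jt_det q (Suc i) lam\<close>, and summing over the rows telescopes.
\<close>

theorem q_fact_mult_jt_det_eq_maj_poly: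
  assumes q: "norm q < 1" and "sorted_wrt (\<ge>) lam" "i \<le> length lam"
  shows "q_fact q (sum_list lam) * jt_det q i lam =
    q ^ sum_list lam * maj_poly q lam
      + (1 - q ^ sum_list lam) * (\<Sum>r=i..<length lam. maj_poly_row q lam r)"
  using assms(2,3)
proof (induction "sum_list lam" arbitrary: lam i)
  case 0
  then have z: "sum_list lam = 0" by simp
  have "maj_poly q lam = 1" by (simp add: maj_poly_def SYT_empty_shape[OF z] maj_def descents_def z)
  then show ?case by (simp add: z jt_det_empty_shape)
next
  case (Suc n)
  let ?m = "length lam"
  have row: "maj_poly_row q lam i = q_fact q n * (jt_det q i lam - jt_det q (Suc i) lam)" if i: "i < ?m" for i
  proof (cases "removable lam i")
    case True
    define lam' where "lam' = lam[i := lam ! i - 1]"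
    have n: "sum_list lam' = n"
      using sum_list_remove[OF Suc.prems(1) True] Suc.hyps(2) by (simp add: lam'_def)
    have "q_fact q n * jt_det q i lam' = q ^ n * maj_poly q lam' + (1 - q ^ n) * (\<Sum>r=i..<?m. maj_poly_row q lam' r)"
      using Suc.hyps(1)[of lam' i] sorted_remove[OF Suc.prems(1) True] i by (simp add: n lam'_def[symmetric]) (simp add: lam'_def)
    then show ?thesis
      using maj_poly_row_remove[OF Suc.prems(1) True, of q] jt_det_diff[OF q i Suc.prems(1)] True n
      by (simp add: lam'_def)
  next
    case False
    then have "SYT_row lam i = {}" by (auto simp: SYT_row_def)
    then show ?thesis using jt_det_diff[OF q i Suc.prems(1)] False by (simp add: maj_poly_row_def)
  qed
  have rows: "(\<Sum>r=i..<?m. maj_poly_row q lam r) = q_fact q n * (jt_det q i lam - q ^ Suc n * jt_det q 0 lam)"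
    if "i \<le> ?m" for i
  proof -
    have "(\<Sum>r=i..<?m. maj_poly_row q lam r) = (\<Sum>r=i..<?m. q_fact q n * jt_det q r lam - q_fact q n * jt_det q (Suc r) lam)"
      by (rule sum.cong) (auto simp: row right_diff_distrib)
    also have "\<dots> = q_fact q n * jt_det q i lam - q_fact q n * jt_det q ?m lam"
      using sum_Suc_diff'[OF that, of "\<lambda>r. - (q_fact q n * jt_det q r lam)"] by simp
    finally show ?thesis
      unfolding jt_det_all_scaled Suc.hyps(2)[symmetric] by (simp add: right_diff_distrib)
  qed
  have P: "maj_poly q lam = q_fact q n * (jt_det q 0 lam - q ^ Suc n * jt_det q 0 lam)"
    using maj_poly_eq_sum_rows[OF Suc.prems(1), of q] Suc.hyps(2)[symmetric] rows[of 0]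
    by (simp only: atLeast0LessThan zero_less_Suc le0)
  show ?case
    unfolding rows[OF Suc.prems(2)] Suc.hyps(2)[symmetric] q_fact_Suc P by (simp add: algebra_simps)
qed

corollary maj_poly_eq_jt_det:
  assumes "norm q < 1" "sorted_wrt (\<ge>) lam"
  shows "maj_poly q lam = q_fact q (sum_list lam) * jt_det q 0 lam"
proof (cases "sum_list lam = 0")
  case True
  show ?thesis using q_fact_mult_jt_det_eq_maj_poly[OF assms, of 0] unfolding True by simp
next
  case False
  then have "maj_poly q lam = (\<Sum>i<length lam. maj_poly_row q lam i)"
    by (intro maj_poly_eq_sum_rows assms neq0_conv[THEN iffD1])
  then show ?thesis
    using q_fact_mult_jt_det_eq_maj_poly[OF assms, of 0]
    by (simp add: atLeast0LessThan algebra_simps)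
qed

section \<open>The q-hook length formula in terms of beta-numbers\<close>

text \<open>
  For a beta-set, the differences \<open>x - y\<close> of the inversions are the hook lengths of the shape.
\<close>

definition inversions :: "nat set \<Rightarrow> (nat \<times> nat) set" where
  "inversions X = {(x, y). x \<in> X \<and> y \<notin> X \<and> y < x}"

lemma finite_inversions: "finite X \<Longrightarrow> finite (inversions X)"
  by (rule finite_subset[of _ "X \<times> {..Max X}"])
     (auto simp: inversions_def intro: less_imp_le order.trans[OF less_imp_le Max_ge])

definition beta_set :: "nat list \<Rightarrow> nat set" where
  "beta_set lam = (\<lambda>r. lam ! r + (length lam - Suc r)) ` {..<length lam}"

context
  fixes lam :: "nat list" and m :: nat and beta :: "nat \<Rightarrow> nat"
  assumes sorted: "sorted_wrt (\<ge>) lam"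
  defines "m \<equiv> length lam"
    and "beta \<equiv> \<lambda>r. lam ! r + (length lam - Suc r)"
begin

lemma beta_less: "r < s \<Longrightarrow> s < m \<Longrightarrow> beta s < beta r"
proof -
  assume a: "r < s" "s < m"
  then have "lam ! s \<le> lam ! r" using sorted by (auto simp: sorted_wrt_iff_nth_less m_def)
  then show ?thesis using a by (simp add: beta_def m_def)
qed

lemma inj_on_beta: "inj_on beta {..<m}"
  by (rule inj_onI) (metis beta_less lessThan_iff less_irrefl linorder_neqE_nat)

lemma beta_set_eq: "beta_set lam = beta ` {..<m}"
  by (simp add: beta_set_def beta_def m_def)

lemma finite_beta_set: "finite (beta_set lam)"
  by (simp add: beta_set_eq)

lemma card_beta_set: "card (beta_set lam) = m"
  by (simp add: beta_set_eq card_image inj_on_beta)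

lemma beta_set_below:
  assumes "r < m"
  shows "{y \<in> beta_set lam. y < beta r} = beta ` {r<..<m}"
proof -
  have "beta s < beta r \<longleftrightarrow> r < s" if "s < m" for s
    using beta_less[of r s] beta_less[of s r] that assms by (cases r s rule: linorder_cases) auto
  then show ?thesis by (auto simp: beta_set_eq)
qed

lemma inj_on_beta_above: "inj_on beta {r<..<m}"
  by (rule inj_on_subset[OF inj_on_beta]) auto

text \<open>
  The inversions with first component \<open>beta r\<close> correspond to the cells of row \<open>r\<close>: of the
  \<open>beta r\<close> smaller numbers, \<open>m - Suc r\<close> belong to the beta-set.
\<close>

lemma card_inversions_beta_set: "card (inversions (beta_set lam)) = sum_list lam"
proof -
  have "inversions (beta_set lam) = (SIGMA x:beta_set lam. {y. y < x \<and> y \<notin> beta_set lam})"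
    by (auto simp: inversions_def)
  then have "card (inversions (beta_set lam)) = (\<Sum>x\<in>beta_set lam. card {y. y < x \<and> y \<notin> beta_set lam})"
    by (simp add: finite_beta_set)
  also have "\<dots> = (\<Sum>r<m. card {y. y < beta r \<and> y \<notin> beta_set lam})"
    by (simp add: beta_set_eq sum.reindex inj_on_beta)
  also have "\<dots> = (\<Sum>r<m. lam ! r)"
  proof (rule sum.cong[OF refl])
    fix r assume "r \<in> {..<m}"
    then have r: "r < m" by simp
    have "{y. y < beta r \<and> y \<notin> beta_set lam} = {..<beta r} - {y \<in> beta_set lam. y < beta r}" by auto
    then have "card {y. y < beta r \<and> y \<notin> beta_set lam} = card ({..<beta r} - {y \<in> beta_set lam. y < beta r})" by simp
    also have "\<dots> = beta r - card {y \<in> beta_set lam. y < beta r}"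
      by (subst card_Diff_subset) (auto simp: finite_beta_set)
    also have "card {y \<in> beta_set lam. y < beta r} = m - Suc r"
      unfolding beta_set_below[OF r] by (simp add: card_image inj_on_beta_above)
    finally show "card {y. y < beta r \<and> y \<notin> beta_set lam} = lam ! r" by (simp add: beta_def m_def)
  qed
  finally show ?thesis by (simp add: sum_list_sum_nth atLeast0LessThan m_def)
qed

text \<open>
  In \<open>jt_det_product\<close>, the factors of \<open>(q)_x\<close> are \<open>1 - q^(x - y)\<close> for \<open>y < x\<close>.  Those with \<open>y\<close> in
  the beta-set cancel against the Vandermonde product, and those of the inversions remain.
\<close>

lemma norm_q_hook_formula:
  assumes q: "norm q < 1" "q \<noteq> 0"
  shows "norm (maj_poly q lam) * norm q ^ (\<Sum>c<m. \<Sum>{..<c}) * (\<Prod>(x, y)\<in>inversions (beta_set lam). norm (1 - q ^ (x - y)))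
    = norm q ^ (\<Sum>x\<in>beta_set lam. \<Sum>y\<in>{y \<in> beta_set lam. y < x}. y) * (\<Prod>j=1..sum_list lam. norm (1 - q ^ j))"
proof -
  let ?X = "beta_set lam"
  define h where "h d = norm (1 - q ^ d)" for d
  have h0: "h d \<noteq> 0" if "d > 0" for d using one_minus_power_nonzero[OF q(1) that] by (simp add: h_def)
  define A where "A = (\<Prod>x\<in>?X. \<Prod>y\<in>{y \<in> ?X. y < x}. h (x - y))"
  define B where "B = (\<Prod>(x, y)\<in>inversions ?X. h (x - y))"
  have A0: "A \<noteq> 0" unfolding A_def using h0 finite_beta_set by simp
  have fact_eq: "norm (q_fact q x) = (\<Prod>y<x. h (x - y))" for x
  proof -
    have "norm (q_fact q x) = (\<Prod>j=1..x. h j)" by (simp add: q_fact_def h_def prod_norm)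
    also have "\<dots> = (\<Prod>y<x. h (x - y))"
      by (rule prod.reindex_bij_witness[of _ "\<lambda>y. x - y" "\<lambda>j. x - j"]) auto
    finally show ?thesis .
  qed
  have "(\<Prod>r<m. norm (q_fact q (beta r))) = (\<Prod>x\<in>?X. norm (q_fact q x))"
    by (simp add: beta_set_eq prod.reindex inj_on_beta)
  also have "\<dots> = (\<Prod>x\<in>?X. (\<Prod>y\<in>{y \<in> ?X. y < x}. h (x - y)) * (\<Prod>y\<in>{y. y < x \<and> y \<notin> ?X}. h (x - y)))"
    unfolding fact_eq
  proof (rule prod.cong[OF refl])
    fix x
    have "{..<x} = {y \<in> ?X. y < x} \<union> {y. y < x \<and> y \<notin> ?X}" by auto
    then show "(\<Prod>y<x. h (x - y)) = (\<Prod>y\<in>{y \<in> ?X. y < x}. h (x - y)) * (\<Prod>y\<in>{y. y < x \<and> y \<notin> ?X}. h (x - y))"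
      by (simp only:) (rule prod.union_disjoint, auto simp: finite_beta_set)
  qed
  also have "\<dots> = A * (\<Prod>x\<in>?X. \<Prod>y\<in>{y. y < x \<and> y \<notin> ?X}. h (x - y))"
    by (simp add: prod.distrib A_def)
  also have "(\<Prod>x\<in>?X. \<Prod>y\<in>{y. y < x \<and> y \<notin> ?X}. h (x - y)) = B"
    unfolding B_def by (subst prod.Sigma) (auto simp: finite_beta_set inversions_def intro!: prod.cong)
  finally have facts: "(\<Prod>r<m. norm (q_fact q (beta r))) = A * B" .
  have "(\<Prod>r<m. \<Prod>s\<in>{r<..<m}. norm (q ^ beta r - q ^ beta s)) = (\<Prod>r<m. \<Prod>y\<in>{y \<in> ?X. y < beta r}. norm (q ^ beta r - q ^ y))"
    by (rule prod.cong) (auto simp: beta_set_below prod.reindex inj_on_beta_above)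
  also have "\<dots> = (\<Prod>x\<in>?X. \<Prod>y\<in>{y \<in> ?X. y < x}. norm (q ^ x - q ^ y))"
    by (simp add: beta_set_eq prod.reindex inj_on_beta)
  also have "\<dots> = (\<Prod>x\<in>?X. \<Prod>y\<in>{y \<in> ?X. y < x}. norm q ^ y * h (x - y))"
  proof (intro prod.cong refl)
    fix x y assume "y \<in> {y \<in> ?X. y < x}"
    then have "q ^ x = q ^ y * q ^ (x - y)" by (simp flip: power_add)
    then have "q ^ x - q ^ y = - (q ^ y * (1 - q ^ (x - y)))" by (simp add: algebra_simps)
    then show "norm (q ^ x - q ^ y) = norm q ^ y * h (x - y)"
      by (simp only: norm_minus_cancel norm_mult norm_power h_def)
  qed
  also have "\<dots> = norm q ^ (\<Sum>x\<in>?X. \<Sum>y\<in>{y \<in> ?X. y < x}. y) * A"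
    by (simp add: prod.distrib A_def power_sum)
  finally have vandermonde: "(\<Prod>r<m. \<Prod>s\<in>{r<..<m}. norm (q ^ beta r - q ^ beta s)) =
     norm q ^ (\<Sum>x\<in>?X. \<Sum>y\<in>{y \<in> ?X. y < x}. y) * A" .
  have "norm (jt_det q 0 lam) * norm q ^ (\<Sum>c<m. \<Sum>{..<c}) * (A * B) =
     norm q ^ (\<Sum>x\<in>?X. \<Sum>y\<in>{y \<in> ?X. y < x}. y) * A"
    using jt_det_product[OF q sorted] facts vandermonde by (simp add: beta_def m_def)
  then have "norm (jt_det q 0 lam) * norm q ^ (\<Sum>c<m. \<Sum>{..<c}) * B = norm q ^ (\<Sum>x\<in>?X. \<Sum>y\<in>{y \<in> ?X. y < x}. y)"
    using A0 by simp
  moreover have "norm (maj_poly q lam) = (\<Prod>j=1..sum_list lam. h j) * norm (jt_det q 0 lam)"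
    unfolding maj_poly_eq_jt_det[OF q(1) sorted] by (simp add: norm_mult q_fact_def h_def prod_norm)
  ultimately show ?thesis by (simp add: B_def h_def mult_ac)
qed

end

section \<open>Radial limits at roots of unity\<close>

abbreviation congruent_inversions :: "nat \<Rightarrow> nat set \<Rightarrow> (nat \<times> nat) set" where
  "congruent_inversions l X \<equiv> {(a, b) \<in> inversions X. a mod l = b mod l}"

text \<open>
  This is the limit of \<open>norm (1 - (t * w) ^ k)\<close> as \<open>t\<close> tends to \<open>1\<close> from the left, after division
  by \<open>1 - t\<close> if \<open>w ^ k = 1\<close>; \<open>radial_factor\<close> is the quotient before passing to the limit.
\<close>

definition root_factor :: "nat \<Rightarrow> complex \<Rightarrow> nat \<Rightarrow> real" where
  "root_factor l w k = (if l dvd k then real k else norm (1 - w ^ k))"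

definition radial_factor :: "nat \<Rightarrow> complex \<Rightarrow> nat \<Rightarrow> real \<Rightarrow> real" where
  "radial_factor l w k t = (if l dvd k then (\<Sum>i<k. t ^ i) else norm (1 - (of_real t * w) ^ k))"

lemma radial_factor_1: "radial_factor l w k 1 = root_factor l w k"
  by (simp add: radial_factor_def root_factor_def)

lemma isCont_radial_factor: "isCont (radial_factor l w k) t"
proof (cases "l dvd k")
  case True
  then have "radial_factor l w k = (\<lambda>t. \<Sum>i<k. t ^ i)" by (simp add: radial_factor_def fun_eq_iff)
  then show ?thesis by (auto intro!: continuous_intros)
next
  case False
  then have "radial_factor l w k = (\<lambda>t. norm (1 - (of_real t * w) ^ k))" by (simp add: radial_factor_def fun_eq_iff)
  then show ?thesis by (auto intro!: continuous_intros)
qed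

lemma congruent_inversions_eq:
  "congruent_inversions l X = {p \<in> inversions X. l dvd fst p - snd p}"
  by (auto simp: inversions_def mod_eq_dvd_iff_nat)

context
  fixes l :: nat and w :: complex
  assumes norm_w: "norm w = 1" and order_w: "\<And>k. w ^ k = 1 \<longleftrightarrow> l dvd k" and l: "l > 0"
begin

lemma root_factor_pos: "k > 0 \<Longrightarrow> root_factor l w k > 0"
  using order_w[of k] by (auto simp: root_factor_def)

lemma norm_one_minus_radial:
  assumes "0 < t" "t < 1"
  shows "norm (1 - (of_real t * w) ^ k) = (if l dvd k then 1 - t else 1) * radial_factor l w k t"
proof (cases "l dvd k")
  case True
  then have "w ^ k = 1" by (simp add: order_w)
  then have "1 - (of_real t * w) ^ k = of_real (1 - t ^ k)" by (simp add: power_mult_distrib)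
  then have "norm (1 - (of_real t * w) ^ k) = \<bar>1 - t ^ k\<bar>" by (simp only: norm_of_real)
  also have "\<dots> = 1 - t ^ k" using assms by (simp add: power_le_one)
  also have "\<dots> = (1 - t) * (\<Sum>i<k. t ^ i)" by (rule one_diff_power_eq)
  finally show ?thesis using True by (simp add: radial_factor_def)
qed (simp add: radial_factor_def)

lemma prod_norm_one_minus_radial:
  assumes "finite A" "0 < t" "t < 1"
  shows "(\<Prod>a\<in>A. norm (1 - (of_real t * w) ^ g a)) =
    (1 - t) ^ card {a \<in> A. l dvd g a} * (\<Prod>a\<in>A. radial_factor l w (g a) t)"
  using assms(1)
  by (simp add: norm_one_minus_radial[OF assms(2,3)] prod.distrib prod.If_cases Int_def)

text \<open>
  Along the radius to \<open>w\<close>, the hook product vanishes to the order of the number of inversions with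
  difference divisible by \<open>l\<close>, and the product of the \<open>1 - q^j\<close> to the order of the number of
  multiples of \<open>l\<close> up to \<open>n\<close>.  Comparing orders forces \<open>maj_poly w lam = 0\<close> unless they agree; if
  they do, the leading terms agree.
\<close>

lemma maj_poly_at_root_of_unity:
  assumes sorted: "sorted_wrt (\<ge>) lam"
  defines "X \<equiv> beta_set lam" and "n \<equiv> sum_list lam"
  shows "card (congruent_inversions l X) = card {j \<in> {1..n}. l dvd j} \<Longrightarrow>
      norm (maj_poly w lam) * (\<Prod>p\<in>inversions X. root_factor l w (fst p - snd p)) = (\<Prod>j=1..n. root_factor l w j)"
    and "card (congruent_inversions l X) \<noteq> card {j \<in> {1..n}. l dvd j} \<Longrightarrow> maj_poly w lam = 0"
proof -
  let ?D = "card (congruent_inversions l X)" and ?s = "card {j \<in> {1..n}. l dvd j}"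
  define a where "a = (\<Sum>c<length lam. \<Sum>{..<c})"
  define b where "b = (\<Sum>x\<in>X. \<Sum>y\<in>{y \<in> X. y < x}. y)"
  define F where "F t = norm (maj_poly (of_real t * w) lam) * t ^ a * (\<Prod>p\<in>inversions X. radial_factor l w (fst p - snd p) t)" for t
  define G where "G t = t ^ b * (\<Prod>j=1..n. radial_factor l w j t)" for t
  have finX: "finite X" unfolding X_def by (rule finite_beta_set[OF sorted])
  have eq: "F t * (1 - t) ^ ?D = G t * (1 - t) ^ ?s" if t: "0 < t" "t < 1" for t
  proof -
    have nq: "norm (of_real t * w) = t" using t norm_w by (simp add: norm_mult)
    then have q: "norm (of_real t * w) < 1" "of_real t * w \<noteq> 0" using t norm_w by auto
    have fin: "finite (inversions X)" by (rule finite_inversions[OF finX])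
    have "(\<Prod>(x, y)\<in>inversions X. norm (1 - (of_real t * w) ^ (x - y))) =
      (1 - t) ^ ?D * (\<Prod>p\<in>inversions X. radial_factor l w (fst p - snd p) t)"
      using prod_norm_one_minus_radial[OF fin t, of "\<lambda>p. fst p - snd p"]
      unfolding congruent_inversions_eq by (simp add: case_prod_unfold)
    moreover have "(\<Prod>j=1..n. norm (1 - (of_real t * w) ^ j)) = (1 - t) ^ ?s * (\<Prod>j=1..n. radial_factor l w j t)"
      using prod_norm_one_minus_radial[of "{1..n}" t "\<lambda>j. j", OF _ t] by simp
    ultimately show ?thesis
      using norm_q_hook_formula[OF sorted q] unfolding nq X_def[symmetric] n_def[symmetric] a_def[symmetric] b_def[symmetric]
      by (simp add: F_def G_def mult_ac)
  qed
  have ev: "\<forall>\<^sub>F t in at_left (1::real). 0 < t \<and> t < 1"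
    unfolding eventually_at_left_field by (rule exI[of _ 0]) auto
  have lim_of_isCont: "(f \<longlongrightarrow> f 1) (at_left 1)" if "isCont f 1" for f :: "real \<Rightarrow> real"
    using that unfolding isCont_def by (rule tendsto_within_subset) simp
  have "isCont F 1"
    unfolding F_def maj_poly_def by (intro continuous_intros isCont_radial_factor)
  note F = lim_of_isCont[OF this]
  have "isCont G 1"
    unfolding G_def by (intro continuous_intros isCont_radial_factor)
  note G = lim_of_isCont[OF this]
  have F1: "F 1 = norm (maj_poly w lam) * (\<Prod>p\<in>inversions X. root_factor l w (fst p - snd p))"
    by (simp add: F_def radial_factor_1)
  have G1: "G 1 = (\<Prod>j=1..n. root_factor l w j)" by (simp add: G_def radial_factor_1)
  have Upos: "(\<Prod>p\<in>inversions X. root_factor l w (fst p - snd p)) > 0"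
    by (rule prod_pos) (auto intro!: root_factor_pos simp: inversions_def)
  have nontriv: "at_left (1::real) \<noteq> bot" by simp
  have vanish: "((\<lambda>t. (1 - t) ^ d) \<longlongrightarrow> 0) (at_left (1::real))" if "d > 0" for d :: nat
    using lim_of_isCont[of "\<lambda>t. (1 - t) ^ d"] that by (simp add: zero_power)
  show "norm (maj_poly w lam) * (\<Prod>p\<in>inversions X. root_factor l w (fst p - snd p)) = (\<Prod>j=1..n. root_factor l w j)"
    if "?D = ?s"
  proof -
    have "\<forall>\<^sub>F t in at_left 1. F t = G t"
      using ev by eventually_elim (use eq that in auto)
    then have "(G \<longlongrightarrow> F 1) (at_left 1)" using F by (rule Lim_transform_eventually[rotated])
    then have "F 1 = G 1" using G by (rule tendsto_unique[OF nontriv])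
    then show ?thesis by (simp add: F1 G1)
  qed
  show "maj_poly w lam = 0" if ne: "?D \<noteq> ?s"
  proof (cases "?D < ?s")
    case True
    have "\<forall>\<^sub>F t in at_left 1. G t * (1 - t) ^ (?s - ?D) = F t"
      using ev
    proof eventually_elim
      case (elim t)
      have "(1 - t) ^ ?s = (1 - t) ^ (?s - ?D) * (1 - t) ^ ?D" using True by (simp flip: power_add)
      then have "F t * (1 - t) ^ ?D = (G t * (1 - t) ^ (?s - ?D)) * (1 - t) ^ ?D"
        using eq[of t] elim by (simp only: mult.assoc)
      then show ?case using elim by simp
    qed
    moreover have "((\<lambda>t. G t * (1 - t) ^ (?s - ?D)) \<longlongrightarrow> G 1 * 0) (at_left 1)"
      by (intro tendsto_mult G vanish) (use True in simp)
    ultimately have "(F \<longlongrightarrow> 0) (at_left 1)" by (auto dest: Lim_transform_eventually)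
    then have "F 1 = 0" using F by (intro tendsto_unique[OF nontriv]) auto
    then show ?thesis using Upos by (simp add: F1)
  next
    case False
    then have lt: "?s < ?D" using ne by simp
    have "\<forall>\<^sub>F t in at_left 1. F t * (1 - t) ^ (?D - ?s) = G t"
      using ev
    proof eventually_elim
      case (elim t)
      have "(1 - t) ^ ?D = (1 - t) ^ (?D - ?s) * (1 - t) ^ ?s" using lt by (simp flip: power_add)
      then have "(F t * (1 - t) ^ (?D - ?s)) * (1 - t) ^ ?s = G t * (1 - t) ^ ?s"
        using eq[of t] elim by (simp only: mult.assoc)
      then show ?case using elim by simp
    qed
    moreover have "((\<lambda>t. F t * (1 - t) ^ (?D - ?s)) \<longlongrightarrow> F 1 * 0) (at_left 1)"
      by (intro tendsto_mult F vanish) (use lt in simp)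
    ultimately have "(G \<longlongrightarrow> 0) (at_left 1)" by (auto dest: Lim_transform_eventually)
    then have "G 1 = 0" using G by (intro tendsto_unique[OF nontriv]) auto
    moreover have "G 1 > 0" unfolding G1 by (rule prod_pos) (auto intro!: root_factor_pos)
    ultimately show ?thesis by simp
  qed
qed

end

lemma maj_poly_1: "maj_poly 1 lam = of_nat (num_SYT lam)"
  by (simp add: maj_poly_def num_SYT_def)

text \<open>
  The case \<open>w = 1\<close>, \<open>l = 1\<close>, where all factors vanish to first order.
\<close>

lemma hook_length_formula:
  assumes sorted: "sorted_wrt (\<ge>) lam"
  shows "num_SYT lam * (\<Prod>(a, b)\<in>inversions (beta_set lam). a - b) = fact (sum_list lam)"
proof -
  have D: "card (congruent_inversions 1 (beta_set lam)) = card {j \<in> {1..sum_list lam}. 1 dvd j}"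
  proof -
    have "{j \<in> {1..sum_list lam}. 1 dvd j} = {1..sum_list lam}" by auto
    then show ?thesis using card_inversions_beta_set[OF sorted] by simp
  qed
  have "norm (maj_poly 1 lam) * (\<Prod>p\<in>inversions (beta_set lam). root_factor 1 1 (fst p - snd p)) =
      (\<Prod>j=1..sum_list lam. root_factor 1 1 j)"
    using D by (intro maj_poly_at_root_of_unity(1) sorted) auto
  then have "real (num_SYT lam * (\<Prod>(a, b)\<in>inversions (beta_set lam). a - b)) = real (\<Prod>j=1..sum_list lam. j)"
    by (simp add: root_factor_def maj_poly_1 case_prod_unfold)
  then show ?thesis by (simp only: of_nat_eq_iff fact_prod of_nat_id)
qed

lemma num_SYT_pos: "sorted_wrt (\<ge>) lam \<Longrightarrow> num_SYT lam > 0"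
  using hook_length_formula[of lam] by (metis fact_nonzero gr0I mult_0)

section \<open>Residue classes of the beta-set\<close>

definition residue_count :: "nat \<Rightarrow> nat set \<Rightarrow> nat \<Rightarrow> nat" where
  "residue_count l A r = card {a \<in> A. a mod l = r}"

lemma residue_count_Un_disjoint:
  assumes "finite A" "finite B" "A \<inter> B = {}"
  shows "residue_count l (A \<union> B) r = residue_count l A r + residue_count l B r"
proof -
  have "{a \<in> A \<union> B. a mod l = r} = {a \<in> A. a mod l = r} \<union> {a \<in> B. a mod l = r}" by auto
  then show ?thesis unfolding residue_count_def using assms
    by (subst card_Un_disjoint[symmetric]) auto
qed

lemma sum_residue_count:
  assumes "finite A" "l > 0"
  shows "(\<Sum>r<l. residue_count l A r) = card A"
proof -
  have "card A = (\<Sum>r<l. card {a \<in> A. a mod l = r})"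
    using assms by (subst card_UN_disjoint[symmetric]) (auto intro!: arg_cong[where f=card])
  then show ?thesis by (simp add: residue_count_def)
qed

lemma residue_count_full:
  assumes "r < l"
  shows "residue_count l {w..<w+l} r = 1"
proof (induction w)
  case 0
  have "{a \<in> {0..<0+l}. a mod l = r} = {r}" using assms by auto
  then show ?case by (simp add: residue_count_def)
next
  case (Suc w)
  have "{w..<w+l} \<union> {w+l} = {Suc w..<Suc w + l} \<union> {w}" using assms by auto
  moreover have "residue_count l ({w..<w+l} \<union> {w+l}) r = residue_count l {w..<w+l} r + residue_count l {w+l} r"
    by (rule residue_count_Un_disjoint) auto
  moreover have "residue_count l ({Suc w..<Suc w+l} \<union> {w}) r = residue_count l {Suc w..<Suc w+l} r + residue_count l {w} r"
    by (rule residue_count_Un_disjoint) auto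
  moreover have "residue_count l {w+l} r = residue_count l {w} r"
  proof -
    have "{a \<in> {w+l}. a mod l = r} = (if w mod l = r then {w+l} else {})" by auto
    moreover have "{a \<in> {w}. a mod l = r} = (if w mod l = r then {w} else {})" by auto
    ultimately show ?thesis by (simp add: residue_count_def)
  qed
  ultimately show ?case using Suc by simp
qed

lemma residue_count_interval:
  assumes "r < l"
  shows "residue_count l {w..<w+k} r \<in> {k div l, k div l + 1}"
proof -
  have "residue_count l {w..<w + l * j + i} r \<in> {j, j + 1}" if "i < l" for i j
  proof (induction j)
    case 0
    have "residue_count l {w..<w+i} r \<le> residue_count l {w..<w+l} r"
      unfolding residue_count_def using that by (intro card_mono) auto
    then show ?case using residue_count_full[OF assms, of w] by (auto simp: le_Suc_eq)
  next
    case (Suc j)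
    have eq: "{w..<w + l * Suc j + i} = {w..<w + l * j + i} \<union> {w + l * j + i..<w + l * j + i + l}"
      by auto
    have "residue_count l {w..<w + l * Suc j + i} r = residue_count l {w..<w + l * j + i} r + 1"
      unfolding eq using residue_count_full[OF assms, of "w + l * j + i"]
      by (subst residue_count_Un_disjoint) auto
    then show ?case using Suc by auto
  qed
  from this[of "k mod l" "k div l"] show ?thesis using assms by (simp add: add.assoc)
qed

lemma residue_count_one: "residue_count (Suc 0) A 0 = card A"
  by (simp add: residue_count_def)

lemma card_congruent_pairs:
  assumes "finite A" "finite B" "l > 0"
  shows "card {(a, b). a \<in> A \<and> b \<in> B \<and> a mod l = b mod l} =
    (\<Sum>r<l. residue_count l A r * residue_count l B r)"
proof -
  have "{(a, b). a \<in> A \<and> b \<in> B \<and> a mod l = b mod l} =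
     (\<Union>r\<in>{..<l}. {a \<in> A. a mod l = r} \<times> {b \<in> B. b mod l = r})"
    using assms by auto
  also have "card \<dots> = (\<Sum>r<l. card ({a \<in> A. a mod l = r} \<times> {b \<in> B. b mod l = r}))"
    by (rule card_UN_disjoint) (use assms in auto)
  finally show ?thesis by (simp add: card_cartesian_product residue_count_def)
qed

lemma residue_count_lessThan:
  assumes "r < l"
  shows "residue_count l {..<l * k} r = k"
proof (induction k)
  case 0
  then show ?case by (simp add: residue_count_def)
next
  case (Suc k)
  have "{..<l * Suc k} = {..<l * k} \<union> {l * k..<l * k + l}" by auto
  moreover have "residue_count l ({..<l * k} \<union> {l * k..<l * k + l}) r =
      residue_count l {..<l * k} r + residue_count l {l * k..<l * k + l} r"
    by (rule residue_count_Un_disjoint) auto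
  ultimately show ?case using residue_count_full[OF assms, of "l * k"] Suc by simp
qed

lemma card_congruent_below:
  assumes "l > 0"
  shows "card {y. y < x \<and> x mod l = y mod l} = x div l"
proof -
  have "{y. y < x \<and> x mod l = y mod l} = (\<lambda>i. l * i + x mod l) ` {..<x div l}"
  proof (intro equalityI subsetI)
    fix y assume y: "y \<in> {y. y < x \<and> x mod l = y mod l}"
    then have "y = l * (y div l) + x mod l" by (metis (mono_tags) mem_Collect_eq mult_div_mod_eq)
    moreover have "y div l < x div l"
    proof (rule ccontr)
      assume "\<not> y div l < x div l"
      then have "l * (x div l) + x mod l \<le> l * (y div l) + y mod l"
        using y by (intro add_mono mult_le_mono2) auto
      then show False using y by simp
    qed
    ultimately show "y \<in> (\<lambda>i. l * i + x mod l) ` {..<x div l}" by auto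
  next
    fix y assume "y \<in> (\<lambda>i. l * i + x mod l) ` {..<x div l}"
    then obtain i where i: "i < x div l" "y = l * i + x mod l" by auto
    then have "l * i < l * (x div l)" using assms by simp
    then have "y < l * (x div l) + x mod l" using i by linarith
    then have "y < x" by (simp only: mult_div_mod_eq)
    then show "y \<in> {y. y < x \<and> x mod l = y mod l}" using i by simp
  qed
  then show ?thesis using assms by (simp add: card_image inj_on_def)
qed

definition congruent_pairs_below :: "nat \<Rightarrow> nat set \<Rightarrow> (nat \<times> nat) set" where
  "congruent_pairs_below l X = {(x, y). x \<in> X \<and> y \<in> X \<and> y < x \<and> x mod l = y mod l}"

lemma finite_congruent_pairs_below: "finite X \<Longrightarrow> finite (congruent_pairs_below l X)"
  by (rule finite_subset[of _ "X \<times> X"]) (auto simp: congruent_pairs_below_def)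

lemma sum_div_eq_card_inversions:
  assumes "finite X" "l > 0"
  shows "(\<Sum>x\<in>X. x div l) = card (congruent_inversions l X) + card (congruent_pairs_below l X)"
proof -
  have "(\<Sum>x\<in>X. x div l) = card (SIGMA x:X. {y. y < x \<and> x mod l = y mod l})"
    using assms by (subst card_SigmaI) (auto simp: card_congruent_below)
  also have "(SIGMA x:X. {y. y < x \<and> x mod l = y mod l}) = congruent_inversions l X \<union> congruent_pairs_below l X"
    by (auto simp: inversions_def congruent_pairs_below_def)
  also have "card \<dots> = card (congruent_inversions l X) + card (congruent_pairs_below l X)"
    using finite_inversions[OF assms(1)] finite_congruent_pairs_below[OF assms(1)]
    by (intro card_Un_disjoint) (auto simp: inversions_def congruent_pairs_below_def elim: finite_subset[rotated])
  finally show ?thesis .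
qed

text \<open>
  The right-hand side counts all ordered congruent pairs: each pair of distinct elements is counted
  twice, and each element is congruent to itself.
\<close>

lemma card_congruent_pairs_below:
  assumes "finite X" "l > 0"
  shows "2 * card (congruent_pairs_below l X) + card X = (\<Sum>r<l. (residue_count l X r)\<^sup>2)"
proof -
  let ?S = "congruent_pairs_below l X"
  have "(\<Sum>r<l. (residue_count l X r)\<^sup>2) = card {(a, b). a \<in> X \<and> b \<in> X \<and> a mod l = b mod l}"
    by (simp add: card_congruent_pairs assms power2_eq_square)
  also have "{(a, b). a \<in> X \<and> b \<in> X \<and> a mod l = b mod l} = (?S \<union> prod.swap ` ?S) \<union> (\<lambda>x. (x, x)) ` X"
    by (auto simp: congruent_pairs_below_def image_iff)
  also have "card \<dots> = card (?S \<union> prod.swap ` ?S) + card ((\<lambda>x. (x, x)) ` X)"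
    using assms(1) finite_congruent_pairs_below[OF assms(1)]
    by (intro card_Un_disjoint) (auto simp: congruent_pairs_below_def)
  also have "card (?S \<union> prod.swap ` ?S) = card ?S + card (prod.swap ` ?S)"
    using assms(1) finite_congruent_pairs_below[OF assms(1)]
    by (intro card_Un_disjoint) (auto simp: congruent_pairs_below_def)
  also have "card (prod.swap ` ?S) = card ?S" by (rule card_image) (auto simp: inj_on_def)
  also have "card ((\<lambda>x. (x, x)) ` X) = card X" by (rule card_image) (auto simp: inj_on_def)
  finally show ?thesis by simp
qed

text \<open>
  Put \<open>e r = residue_count l X r - k\<close>, so that these numbers sum to zero.  Expressing both sides
  of the hypothesis on the inversions through the sum of \<open>X\<close>, the sum of the quotients \<open>x div l\<close>,
  and the residue counts turns it into \<open>\<Sum> (l * e r ^ 2 + 2 * r * e r) = 0\<close>.  Since the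
  \<open>e r\<close> sum to zero, \<open>2 * r\<close> may be replaced by \<open>2 * r - (l - 1)\<close>, of absolute value less than
  \<open>l\<close>, after which every summand is at least \<open>|e r|\<close>.
\<close>

lemma residue_balanced:
  assumes X: "finite X" "card X = l * k" and l: "l > 0"
    and weight: "card (inversions X) = l * card (congruent_inversions l X)"
    and r: "r < l"
  shows "residue_count l X r = k"
proof -
  define c where "c r = int (residue_count l X r)" for r
  define e where "e r = c r - int k" for r
  have sumc: "(\<Sum>r<l. c r) = int (l * k)"
    using sum_residue_count[OF X(1) l] X(2) by (simp add: c_def flip: of_nat_sum)
  then have sume: "(\<Sum>r<l. e r) = 0" by (simp add: e_def sum_subtractf)
  have sumX: "int (\<Sum>x\<in>X. x) = int l * int (\<Sum>x\<in>X. x div l) + (\<Sum>r<l. int r * c r)"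
  proof -
    have "(\<Sum>x\<in>X. x) = (\<Sum>x\<in>X. l * (x div l) + x mod l)" by simp
    also have "\<dots> = l * (\<Sum>x\<in>X. x div l) + (\<Sum>x\<in>X. x mod l)"
      by (simp only: sum.distrib sum_distrib_left)
    also have "(\<Sum>x\<in>X. x mod l) = (\<Sum>r<l. \<Sum>x\<in>{x\<in>X. x mod l = r}. x mod l)"
      using X(1) l by (intro sum.group[symmetric]) auto
    also have "\<dots> = (\<Sum>r<l. r * residue_count l X r)"
      by (rule sum.cong) (auto simp: residue_count_def)
    finally show ?thesis by (simp add: c_def)
  qed
  have one: "(\<Sum>x\<in>X. x) = card (inversions X) + card (congruent_pairs_below 1 X)"
    using sum_div_eq_card_inversions[OF X(1), of 1] by simp
  have S1: "2 * card (congruent_pairs_below 1 X) + card X = (card X)\<^sup>2"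
    using card_congruent_pairs_below[OF X(1), of 1] by (simp add: residue_count_one)
  have Sl: "2 * int (card (congruent_pairs_below l X)) + int (card X) = (\<Sum>r<l. (c r)\<^sup>2)"
    using card_congruent_pairs_below[OF X(1) l] by (simp add: c_def flip: of_nat_power of_nat_sum)
  have "2 * (\<Sum>r<l. int r * c r) + int l * ((\<Sum>r<l. (c r)\<^sup>2) - int (card X)) = (int (card X))\<^sup>2 - int (card X)"
  proof -
    have "int (card (inversions X)) + int (card (congruent_pairs_below 1 X)) =
      int l * (int (card (congruent_inversions l X)) + int (card (congruent_pairs_below l X))) + (\<Sum>r<l. int r * c r)"
      using sumX one sum_div_eq_card_inversions[OF X(1) l] by (simp only: of_nat_add)
    then have "int (card (congruent_pairs_below 1 X)) = int l * int (card (congruent_pairs_below l X)) + (\<Sum>r<l. int r * c r)"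
      using weight by (simp add: distrib_left)
    moreover have "2 * int (card (congruent_pairs_below 1 X)) + int (card X) = (int (card X))\<^sup>2"
      using S1 by (metis of_nat_add of_nat_mult of_nat_numeral of_nat_power)
    moreover have "int l * (2 * int (card (congruent_pairs_below l X)) + int (card X)) = int l * (\<Sum>r<l. (c r)\<^sup>2)"
      using Sl by simp
    ultimately show ?thesis by (simp add: algebra_simps)
  qed
  moreover have "(\<Sum>r<l. (c r)\<^sup>2) = int l * (int k)\<^sup>2 + (\<Sum>r<l. (e r)\<^sup>2)"
  proof -
    have "(\<Sum>r<l. (c r)\<^sup>2) = (\<Sum>r<l. (int k)\<^sup>2 + 2 * int k * e r + (e r)\<^sup>2)"
      by (rule sum.cong) (auto simp: e_def power2_eq_square algebra_simps)
    then show ?thesis by (simp add: sum.distrib sume flip: sum_distrib_left)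
  qed
  moreover have "2 * (\<Sum>r<l. int r * c r) = int k * (int l * (int l - 1)) + (\<Sum>r<l. (2 * int r - (int l - 1)) * e r)"
  proof -
    have "2 * (\<Sum>r<l. int r) = int l * (int l - 1)" by (induction l) (auto simp: algebra_simps)
    moreover have "2 * (\<Sum>r<l. int r * c r) = (\<Sum>r<l. int k * (2 * int r) + (int l - 1) * e r + (2 * int r - (int l - 1)) * e r)"
      unfolding sum_distrib_left by (rule sum.cong) (auto simp: e_def algebra_simps)
    ultimately show ?thesis by (simp add: sum.distrib sume flip: sum_distrib_left)
  qed
  ultimately have zero: "(\<Sum>r<l. int l * (e r)\<^sup>2 + (2 * int r - (int l - 1)) * e r) = 0"
    unfolding sum.distrib sum_distrib_left[symmetric] X(2) by (simp add: power2_eq_square algebra_simps)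
  have pos: "int l * (e r)\<^sup>2 + (2 * int r - (int l - 1)) * e r \<ge> \<bar>e r\<bar>" if "r < l" for r
  proof -
    have "\<bar>(2 * int r - (int l - 1)) * e r\<bar> \<le> (int l - 1) * \<bar>e r\<bar>"
      unfolding abs_mult using that by (intro mult_right_mono) auto
    moreover have "\<bar>e r\<bar> * 1 \<le> \<bar>e r\<bar> * \<bar>e r\<bar>"
    proof (cases "e r = 0")
      case False
      then show ?thesis by (intro mult_left_mono) linarith+
    qed simp
    then have "int l * \<bar>e r\<bar> \<le> int l * (e r)\<^sup>2"
      by (intro mult_left_mono) (auto simp: power2_eq_square abs_mult[symmetric])
    ultimately show ?thesis by (simp add: algebra_simps)
  qed
  then have "int l * (e r)\<^sup>2 + (2 * int r - (int l - 1)) * e r = 0"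
    using sum_nonneg_eq_0_iff[of "{..<l}" "\<lambda>r. int l * (e r)\<^sup>2 + (2 * int r - (int l - 1)) * e r"] zero r
      order.trans[OF abs_ge_zero pos] by auto
  then have "e r = 0" using pos[OF r] by simp
  then show ?thesis by (simp add: e_def c_def)
qed

lemma prod_periodic:
  fixes f :: "nat \<Rightarrow> 'a :: comm_monoid_mult"
  assumes "\<And>j. f (j + l) = f j"
  shows "(\<Prod>j<l * i + r. f j) = (\<Prod>j<l. f j) ^ i * (\<Prod>j<r. f j)"
proof (induction i)
  case (Suc i)
  have shift: "(\<Prod>j<l + y. f j) = (\<Prod>j<l. f j) * (\<Prod>j<y. f j)" for y
  proof (induction y)
    case (Suc y)
    then show ?case using assms[of y] by (simp add: add.commute mult.assoc)
  qed simp
  have "(\<Prod>j<l * Suc i + r. f j) = (\<Prod>j<l + (l * i + r). f j)" by (simp add: add.assoc)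
  then show ?case by (simp only: shift Suc.IH power_Suc mult.assoc)
qed simp

lemma prod_mod_eq:
  fixes F :: "nat \<Rightarrow> 'a :: comm_monoid_mult"
  assumes "finite X" "l > 0"
  shows "(\<Prod>x\<in>X. F (x mod l)) = (\<Prod>r<l. F r ^ residue_count l X r)"
proof -
  have "(\<Prod>x\<in>X. F (x mod l)) = (\<Prod>r<l. \<Prod>x\<in>{x\<in>X. x mod l = r}. F (x mod l))"
    using assms by (intro prod.group[symmetric]) auto
  also have "\<dots> = (\<Prod>r<l. F r ^ residue_count l X r)"
    by (rule prod.cong) (auto simp: residue_count_def)
  finally show ?thesis .
qed

context
  fixes l :: nat and w :: complex
  assumes norm_w: "norm w = 1" and order_w: "\<And>k. w ^ k = 1 \<longleftrightarrow> l dvd k" and l: "l > 0"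
begin

text \<open>
  The distance of two powers of \<open>w\<close>, with the value \<open>1\<close> in place of \<open>0\<close> so that coinciding powers
  do not affect products.
\<close>

definition chord :: "nat \<Rightarrow> nat \<Rightarrow> real" where
  "chord x y = (if x mod l = y mod l then 1 else norm (w ^ x - w ^ y))"

lemma power_eq_iff_mod: "w ^ x = w ^ y \<longleftrightarrow> x mod l = y mod l"
proof -
  have *: "w ^ x = w ^ y \<longleftrightarrow> x mod l = y mod l" if "y \<le> x" for x y
  proof -
    have "w ^ x = w ^ y * w ^ (x - y)" using that by (simp flip: power_add)
    moreover have "w \<noteq> 0" using norm_w by auto
    ultimately have "w ^ x = w ^ y \<longleftrightarrow> w ^ (x - y) = 1" by simp
    then show ?thesis using that by (simp add: order_w mod_eq_dvd_iff_nat)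
  qed
  show ?thesis using *[of x y] *[of y x] by (cases "y \<le> x") auto
qed

lemma chord_pos: "chord x y > 0"
  by (simp add: chord_def power_eq_iff_mod)

lemma chord_commute: "chord x y = chord y x"
  by (simp add: chord_def norm_minus_commute)

lemma chord_mod: "chord x y = chord (x mod l) (y mod l)"
proof -
  have "w ^ x = w ^ (x mod l)" for x by (simp add: power_eq_iff_mod)
  then show ?thesis by (simp add: chord_def)
qed

lemma chord_diff: "y \<le> x \<Longrightarrow> chord x y = chord (x - y) 0"
proof -
  assume a: "y \<le> x"
  then have "w ^ x - w ^ y = w ^ y * (w ^ (x - y) - 1)" by (simp add: algebra_simps flip: power_add)
  then have "norm (w ^ x - w ^ y) = norm (w ^ (x - y) - 1)" by (simp add: norm_mult norm_power norm_w)
  moreover have "x mod l = y mod l \<longleftrightarrow> (x - y) mod l = 0" using a by (simp add: mod_eq_dvd_iff_nat dvd_eq_mod_eq_0)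
  ultimately show ?thesis by (simp add: chord_def)
qed

lemma prod_chord_below:
  "(\<Prod>y<x. chord x y) = (\<Prod>j<l. chord (Suc j) 0) ^ (x div l) * (\<Prod>j<x mod l. chord (Suc j) 0)"
proof -
  have "(\<Prod>y<x. chord x y) = (\<Prod>j<x. chord (Suc j) 0)"
  proof (rule prod.reindex_bij_witness[of _ "\<lambda>j. x - Suc j" "\<lambda>y. x - Suc y"])
    show "chord (Suc (x - Suc y)) 0 = chord x y" if "y \<in> {..<x}" for y
      using chord_diff[of y x] that by (simp add: Suc_diff_Suc)
  qed auto
  also have "\<dots> = (\<Prod>j<l * (x div l) + x mod l. chord (Suc j) 0)" by simp
  also have "\<dots> = (\<Prod>j<l. chord (Suc j) 0) ^ (x div l) * (\<Prod>j<x mod l. chord (Suc j) 0)"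
  proof (rule prod_periodic)
    show "chord (Suc (j + l)) 0 = chord (Suc j) 0" for j
      by (subst chord_mod, subst (2) chord_mod) (simp flip: add_Suc)
  qed
  finally show ?thesis .
qed

text \<open>
  For any set \<open>Y\<close> with \<open>k\<close> elements in each residue class, the product of \<open>chord x y\<close> over
  \<open>x \<in> Y\<close> and \<open>y < x\<close> is known from \<open>prod_chord_below\<close>.  It splits into the product over the
  inversions and the product over pairs in \<open>Y\<close>.  The square of the latter depends on \<open>l\<close> and \<open>k\<close>
  only, so it can be evaluated on the initial segment \<open>V\<close>, which has no inversions.
\<close>

lemma prod_chord_inversions:
  assumes X: "finite X" "\<And>r. r < l \<Longrightarrow> residue_count l X r = k"
  shows "(\<Prod>p\<in>inversions X. chord (fst p) (snd p)) = (\<Prod>j<l. chord (Suc j) 0) ^ card (congruent_inversions l X)"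
proof -
  let ?R = "\<Prod>j<l. chord (Suc j) 0"
  define Q where "Q Y = (\<Prod>x\<in>Y. \<Prod>y\<in>{y \<in> Y. y < x}. chord x y)" for Y
  define B where "B Y = (\<Prod>p\<in>inversions Y. chord (fst p) (snd p))" for Y
  define C where "C = (\<Prod>r<l. (\<Prod>j<r. chord (Suc j) 0) ^ k)"
  define V where "V = {..<l * k}"
  have V: "finite V" "\<And>r. r < l \<Longrightarrow> residue_count l V r = k"
    by (simp_all add: V_def residue_count_lessThan)
  have R: "?R > 0" and C: "C > 0" unfolding C_def by (auto intro!: prod_pos chord_pos zero_less_power)
  have Q_pos: "Q Y > 0" for Y unfolding Q_def by (intro prod_pos) (auto intro!: prod_pos chord_pos)
  have BQ: "B Y * Q Y = ?R ^ (\<Sum>x\<in>Y. x div l) * C"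
    if Y: "finite Y" "\<And>r. r < l \<Longrightarrow> residue_count l Y r = k" for Y
  proof -
    have "(\<Prod>x\<in>Y. \<Prod>y<x. chord x y) = (\<Prod>x\<in>Y. (\<Prod>y\<in>{y. y < x \<and> y \<notin> Y}. chord x y) * (\<Prod>y\<in>{y \<in> Y. y < x}. chord x y))"
    proof (rule prod.cong[OF refl])
      fix x
      have "{..<x} = {y. y < x \<and> y \<notin> Y} \<union> {y \<in> Y. y < x}" by auto
      then show "(\<Prod>y<x. chord x y) = (\<Prod>y\<in>{y. y < x \<and> y \<notin> Y}. chord x y) * (\<Prod>y\<in>{y \<in> Y. y < x}. chord x y)"
        by (simp only:) (rule prod.union_disjoint, auto simp: Y)
    qed
    also have "\<dots> = (\<Prod>x\<in>Y. \<Prod>y\<in>{y. y < x \<and> y \<notin> Y}. chord x y) * Q Y"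
      by (simp add: prod.distrib Q_def)
    also have "(\<Prod>x\<in>Y. \<Prod>y\<in>{y. y < x \<and> y \<notin> Y}. chord x y) = B Y"
      unfolding B_def by (subst prod.Sigma) (auto simp: Y inversions_def intro!: prod.cong)
    finally have "B Y * Q Y = (\<Prod>x\<in>Y. ?R ^ (x div l) * (\<Prod>j<x mod l. chord (Suc j) 0))"
      by (simp only: prod_chord_below)
    also have "\<dots> = ?R ^ (\<Sum>x\<in>Y. x div l) * (\<Prod>r<l. (\<Prod>j<r. chord (Suc j) 0) ^ residue_count l Y r)"
      by (simp add: prod.distrib power_sum prod_mod_eq[OF Y(1) l, of "\<lambda>r. \<Prod>j<r. chord (Suc j) 0"])
    also have "(\<Prod>r<l. (\<Prod>j<r. chord (Suc j) 0) ^ residue_count l Y r) = C"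
      unfolding C_def by (rule prod.cong) (auto simp: Y)
    finally show ?thesis .
  qed
  have Q2: "Q Y * Q Y = (\<Prod>r<l. (\<Prod>r'<l. chord r r' ^ k) ^ k)"
    if Y: "finite Y" "\<And>r. r < l \<Longrightarrow> residue_count l Y r = k" for Y
  proof -
    have "Q Y = (\<Prod>y\<in>Y. \<Prod>x\<in>{x \<in> Y. y < x}. chord x y)"
      unfolding Q_def by (rule prod.swap_restrict) (auto simp: Y)
    then have Q': "Q Y = (\<Prod>x\<in>Y. \<Prod>y\<in>{y \<in> Y. x < y}. chord x y)" by (simp add: chord_commute)
    have "Q Y * Q Y = (\<Prod>x\<in>Y. (\<Prod>y\<in>{y \<in> Y. y < x}. chord x y) * (\<Prod>y\<in>{y \<in> Y. x < y}. chord x y))"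
      by (subst (2) Q') (simp add: Q_def prod.distrib)
    also have "\<dots> = (\<Prod>x\<in>Y. \<Prod>y\<in>Y. chord x y)"
    proof (rule prod.cong[OF refl])
      fix x assume x: "x \<in> Y"
      have "(\<Prod>y\<in>Y. chord x y) = (\<Prod>y\<in>({y \<in> Y. y < x} \<union> {y \<in> Y. x < y}) \<union> {x}. chord x y)"
        using x by (intro prod.cong) auto
      also have "\<dots> = (\<Prod>y\<in>{y \<in> Y. y < x}. chord x y) * (\<Prod>y\<in>{y \<in> Y. x < y}. chord x y) * chord x x"
        using Y by (subst prod.union_disjoint, simp, simp, force, subst prod.union_disjoint) auto
      finally show "(\<Prod>y\<in>{y \<in> Y. y < x}. chord x y) * (\<Prod>y\<in>{y \<in> Y. x < y}. chord x y) = (\<Prod>y\<in>Y. chord x y)"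
        by (simp add: chord_def)
    qed
    also have "\<dots> = (\<Prod>x\<in>Y. \<Prod>y\<in>Y. chord (x mod l) (y mod l))"
      by (intro prod.cong refl chord_mod)
    also have "\<dots> = (\<Prod>x\<in>Y. \<Prod>r'<l. chord (x mod l) r' ^ residue_count l Y r')"
      by (intro prod.cong refl prod_mod_eq[OF Y(1) l])
    also have "\<dots> = (\<Prod>r<l. (\<Prod>r'<l. chord r r' ^ residue_count l Y r') ^ residue_count l Y r)"
      by (rule prod_mod_eq[OF Y(1) l, of "\<lambda>a. \<Prod>r'<l. chord a r' ^ residue_count l Y r'"])
    also have "\<dots> = (\<Prod>r<l. (\<Prod>r'<l. chord r r' ^ k) ^ k)"
      by (intro prod.cong refl) (simp add: Y)
    finally show ?thesis .
  qed
  have "Q X = Q V"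
  proof -
    have "(Q X)\<^sup>2 = (Q V)\<^sup>2" using Q2[OF X] Q2[OF V] by (simp add: power2_eq_square)
    then show ?thesis using Q_pos[of X] Q_pos[of V] by (simp add: power2_eq_iff)
  qed
  have invV: "inversions V = {}" by (auto simp: inversions_def V_def)
  have "(\<Sum>x\<in>X. x div l) = card (congruent_inversions l X) + (\<Sum>x\<in>V. x div l)"
  proof -
    have cX: "card X = l * k" using sum_residue_count[OF X(1) l] X(2) by simp
    have "2 * card (congruent_pairs_below l X) + card X = 2 * card (congruent_pairs_below l V) + card V"
      using X V by (simp add: card_congruent_pairs_below l)
    then have "card (congruent_pairs_below l X) = card (congruent_pairs_below l V)"
      using cX by (simp add: V_def)
    then show ?thesis
      using sum_div_eq_card_inversions[OF X(1) l] sum_div_eq_card_inversions[OF V(1) l] by (simp add: invV)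
  qed
  moreover have "B X * Q V = ?R ^ (\<Sum>x\<in>X. x div l) * C" using BQ[OF X] \<open>Q X = Q V\<close> by simp
  moreover have "Q V = ?R ^ (\<Sum>x\<in>V. x div l) * C" using BQ[OF V] by (simp add: B_def invV)
  ultimately have "B X * (?R ^ (\<Sum>x\<in>V. x div l) * C) = ?R ^ card (congruent_inversions l X) * (?R ^ (\<Sum>x\<in>V. x div l) * C)"
    by (simp add: power_add)
  moreover have "?R ^ (\<Sum>x\<in>V. x div l) * C > 0" by (intro mult_pos_pos zero_less_power R C)
  ultimately show ?thesis unfolding B_def[symmetric] by (simp only: mult_right_cancel[OF less_imp_neq[symmetric]])
qed

text \<open>
  By balancedness, the factors \<open>norm (1 - w ^ j)\<close> with \<open>w ^ j \<noteq> 1\<close> contribute the same amount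
  to the hook product as to the product over \<open>j \<le> n\<close>, so they cancel.
\<close>

lemma norm_maj_poly_mult_prod_congruent:
  assumes sorted: "sorted_wrt (\<ge>) lam"
    and n: "sum_list lam = l * s" and len: "length lam = l * k"
    and nz: "maj_poly w lam \<noteq> 0"
  defines "X \<equiv> beta_set lam"
  shows "card (inversions X) = l * card (congruent_inversions l X)"
    and "norm (maj_poly w lam) * real (\<Prod>(a, b)\<in>congruent_inversions l X. a - b) = real (\<Prod>i=1..s. l * i)"
proof -
  let ?H = "congruent_inversions l X" and ?R = "\<Prod>j<l. chord (Suc j) 0"
  note fin = finite_beta_set[OF sorted, folded X_def]
  have mult: "{j \<in> {1..l * s}. l dvd j} = (\<lambda>i. l * i) ` {1..s}"
    using l by (auto simp: image_iff elim!: dvdE) 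
  have inj: "inj_on (\<lambda>i. l * i) {1..s}" using l by (auto simp: inj_on_def)
  have D: "card ?H = card {j \<in> {1..l * s}. l dvd j}"
    using nz maj_poly_at_root_of_unity(2)[OF norm_w order_w l sorted] by (auto simp: X_def n)
  then have Ds: "card ?H = s" unfolding mult card_image[OF inj] by simp
  have weight: "card (inversions X) = l * card ?H"
    using card_inversions_beta_set[OF sorted] unfolding X_def[symmetric] Ds n by simp
  have bal: "residue_count l X r = k" if "r < l" for r
    by (rule residue_balanced[OF fin _ l weight that]) (unfold X_def card_beta_set[OF sorted] len, rule refl)
  have split: "(\<Prod>a\<in>A. root_factor l w (g a)) = (\<Prod>a\<in>{a \<in> A. l dvd g a}. real (g a)) * (\<Prod>a\<in>A. chord (g a) 0)"
    if "finite A" for A :: "'b set" and g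
  proof -
    have "root_factor l w j = (if l dvd j then real j else 1) * chord j 0" for j
      by (auto simp: root_factor_def chord_def norm_minus_commute)
    then show ?thesis using that by (simp add: prod.distrib prod.If_cases Int_def)
  qed
  have H: "(\<Prod>p\<in>inversions X. root_factor l w (fst p - snd p)) = real (\<Prod>(a, b)\<in>?H. a - b) * ?R ^ s"
  proof -
    have "(\<Prod>p\<in>inversions X. chord (fst p - snd p) 0) = (\<Prod>p\<in>inversions X. chord (fst p) (snd p))"
    proof (rule prod.cong[OF refl])
      fix p assume "p \<in> inversions X"
      then have "snd p \<le> fst p" by (auto simp: inversions_def)
      then show "chord (fst p - snd p) 0 = chord (fst p) (snd p)" by (rule chord_diff[symmetric])
    qed
    also have "\<dots> = ?R ^ s" using prod_chord_inversions[OF fin bal] Ds by simp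
    finally show ?thesis
      unfolding split[OF finite_inversions[OF fin]] congruent_inversions_eq by (simp add: case_prod_unfold)
  qed
  have N: "(\<Prod>j=1..l * s. root_factor l w j) = real (\<Prod>i=1..s. l * i) * ?R ^ s"
  proof -
    have "(\<Prod>j\<in>{1..l * s}. chord j 0) = (\<Prod>j<l * s + 0. chord (Suc j) 0)"
      by (rule prod.reindex_bij_witness[of _ Suc "\<lambda>j. j - 1"]) auto
    also have "\<dots> = ?R ^ s"
    proof -
      have "chord (Suc (j + l)) 0 = chord (Suc j) 0" for j
        by (subst chord_mod, subst (2) chord_mod) (simp flip: add_Suc)
      then show ?thesis by (subst prod_periodic) auto
    qed
    finally have c: "(\<Prod>j\<in>{1..l * s}. chord j 0) = ?R ^ s" .
    have "(\<Prod>j=1..l * s. root_factor l w j) = (\<Prod>j\<in>{j \<in> {1..l * s}. l dvd j}. real j) * ?R ^ s"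
      using split[of "{1..l * s}" "\<lambda>j. j"] c by simp
    also have "(\<Prod>j\<in>{j \<in> {1..l * s}. l dvd j}. real j) = (\<Prod>i=1..s. real (l * i))"
      unfolding mult prod.reindex[OF inj] by simp
    finally show ?thesis by simp
  qed
  have "?R ^ s > 0" by (intro zero_less_power prod_pos) (simp add: chord_pos)
  then have R: "?R ^ s \<noteq> 0" by (rule less_imp_neq[symmetric])
  have "norm (maj_poly w lam) * real (\<Prod>(a, b)\<in>?H. a - b) * ?R ^ s = real (\<Prod>i=1..s. l * i) * ?R ^ s"
    using maj_poly_at_root_of_unity(1)[OF norm_w order_w l sorted] D
    unfolding X_def[symmetric] n H N by (simp add: mult.assoc)
  then show "norm (maj_poly w lam) * real (\<Prod>(a, b)\<in>?H. a - b) = real (\<Prod>i=1..s. l * i)"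
    unfolding mult_right_cancel[OF R] .
  show "card (inversions X) = l * card ?H" by (rule weight)
qed

end

section \<open>Counting congruent pairs in a window\<close>

lemma int_mult_nonpos_of_sum_01:
  fixes a b :: int
  assumes "a + b \<in> {0, 1}"
  shows "a * b \<le> 0"
proof -
  have "b = - a \<or> b = 1 - a" using assms by auto
  moreover have "a * (1 - a) \<le> 0" by (cases "a \<le> 0") (auto simp: mult_le_0_iff)
  ultimately show ?thesis by auto
qed

text \<open>
  The value of \<open>\<Sum>r<l. c r * c' r\<close> for two families of counts with sums \<open>v\<close> and \<open>v'\<close> that
  are spread over the \<open>l\<close> classes as evenly as possible and whose larger values overlap as little as
  possible: the last summand is the size of the unavoidable overlap.
\<close>

definition balanced_pairing :: "nat \<Rightarrow> nat \<Rightarrow> nat \<Rightarrow> int" where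
  "balanced_pairing l v v' = int (l * (v div l) * (v' div l) + (v div l) * (v' mod l) + (v' div l) * (v mod l))
     + max 0 (int (v mod l) + int (v' mod l) - int l)"

text \<open>
  With \<open>p\<close> and \<open>p'\<close> the remainders of \<open>v\<close> and \<open>v'\<close>, the difference of the two sides is \<open>p * p'\<close>
  or \<open>(l - p) * (l - p')\<close>.
\<close>

lemma balanced_pairing_le:
  assumes "l > 0"
  shows "int l * balanced_pairing l v v' \<le> int (v * v')"
proof -
  define q p q' p' where "q = int (v div l)" "p = int (v mod l)" "q' = int (v' div l)" "p' = int (v' mod l)"
  have v: "int v = int l * q + p" "int v' = int l * q' + p'"
    by (simp_all add: q_p_q'_p'_def flip: of_nat_mult of_nat_add)
  have p: "0 \<le> p" "p < l" "0 \<le> p'" "p' < l" using assms by (auto simp: q_p_q'_p'_def)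
  have "int (v * v') - int l * balanced_pairing l v v' = p * p' - l * max 0 (p + p' - l)"
    unfolding balanced_pairing_def by (simp add: v flip: q_p_q'_p'_def) (simp add: algebra_simps)
  also have "\<dots> \<ge> 0"
  proof (cases "p + p' \<le> l")
    case True
    then show ?thesis using p by simp
  next
    case False
    then have "p * p' - l * max 0 (p + p' - l) = (l - p) * (l - p')" by (simp add: algebra_simps)
    then show ?thesis using p by simp
  qed
  finally show ?thesis by simp
qed

text \<open>
  Subtract the integer quotients of \<open>v\<close> and \<open>v'\<close> from the counts.  The sum of the two deviations in
  a class is then \<open>0\<close> or \<open>1\<close>, in which case their product is nonpositive, or it is \<open>1\<close> or \<open>2\<close>,
  in which case the same holds for the complements of the deviations to \<open>1\<close>.  If all deviations
  are \<open>0\<close> or \<open>1\<close>, these products are zero.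
\<close>

lemma sum_mult_le_balanced_pairing:
  fixes c c' :: "nat \<Rightarrow> int"
  assumes l: "l > 0"
    and sums: "(\<Sum>r<l. c r) = int v" "(\<Sum>r<l. c' r) = int v'"
    and tot: "\<And>r. r < l \<Longrightarrow> c r + c' r \<in> {int ((v + v') div l), int ((v + v') div l) + 1}"
  shows "(\<Sum>r<l. c r * c' r) \<le> balanced_pairing l v v'"
    and "(\<And>r. r < l \<Longrightarrow> c r \<in> {int (v div l), int (v div l) + 1}) \<Longrightarrow>
         (\<And>r. r < l \<Longrightarrow> c' r \<in> {int (v' div l), int (v' div l) + 1}) \<Longrightarrow>
         (\<Sum>r<l. c r * c' r) = balanced_pairing l v v'"
proof -
  define q p q' p' where qp: "q = int (v div l)" "p = int (v mod l)" "q' = int (v' div l)" "p' = int (v' mod l)"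
  have v: "int v = int l * q + p" "int v' = int l * q' + p'"
    by (simp_all add: qp flip: of_nat_mult of_nat_add)
  have p: "0 \<le> p" "p < l" "0 \<le> p'" "p' < l" using l by (auto simp: qp)
  define a a' where a: "a = (\<lambda>r. c r - q)" "a' = (\<lambda>r. c' r - q')"
  have sa: "(\<Sum>r<l. a r) = p" "(\<Sum>r<l. a' r) = p'"
    using sums v by (auto simp: a sum_subtractf)
  have expand: "(\<Sum>r<l. c r * c' r) = int l * q * q' + q * p' + q' * p + (\<Sum>r<l. a r * a' r)"
  proof -
    have "(\<Sum>r<l. c r * c' r) = (\<Sum>r<l. q * q' + q * a' r + q' * a r + a r * a' r)"
      by (rule sum.cong) (auto simp: a algebra_simps)
    then show ?thesis by (simp add: sum.distrib sa flip: sum_distrib_left)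
  qed
  have target: "balanced_pairing l v v' = int l * q * q' + q * p' + q' * p + max 0 (p + p' - l)"
    by (simp add: balanced_pairing_def qp)
  have dv: "int ((v + v') div l) = q + q' + (if p + p' < l then 0 else 1)"
  proof -
    have "int ((v + v') div l) = (int l * (q + q') + (p + p')) div int l"
      by (simp add: zdiv_int v algebra_simps)
    also have "\<dots> = q + q' + (p + p') div int l" using l by simp
    also have "(p + p') div int l = (if p + p' < l then 0 else 1)"
    proof (cases "p + p' < l")
      case False
      then have "(p + p') div int l = (p + p' - l) div int l + 1"
        using l div_add_self2[of "int l" "p + p' - l"] by simp
      then show ?thesis using False p by simp
    qed (use p in simp)
    finally show ?thesis .
  qed
  have "(\<Sum>r<l. a r * a' r) \<le> max 0 (p + p' - l) \<and>
     ((\<forall>r<l. a r \<in> {0,1}) \<longrightarrow> (\<forall>r<l. a' r \<in> {0,1}) \<longrightarrow> (\<Sum>r<l. a r * a' r) = max 0 (p + p' - l))"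
  proof (cases "p + p' < l")
    case True
    have t: "a r + a' r \<in> {0, 1}" if "r < l" for r using tot[OF that] True dv by (auto simp: a)
    have "(\<Sum>r<l. a r * a' r) \<le> 0"
      by (intro sum_nonpos int_mult_nonpos_of_sum_01) (use t in auto)
    moreover have "(\<Sum>r<l. a r * a' r) = 0" if "\<forall>r<l. a r \<in> {0,1}" "\<forall>r<l. a' r \<in> {0,1}"
    proof (rule sum.neutral, rule ballI)
      fix r assume "r \<in> {..<l}"
      then show "a r * a' r = 0" using that t[of r] by force
    qed
    ultimately show ?thesis using True by auto
  next
    case False
    define b b' where b: "b = (\<lambda>r. 1 - a r)" "b' = (\<lambda>r. 1 - a' r)"
    have t: "b r + b' r \<in> {0, 1}" if "r < l" for r using tot[OF that] False dv by (auto simp: a b)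
    have ex: "(\<Sum>r<l. a r * a' r) = p + p' - l + (\<Sum>r<l. b r * b' r)"
    proof -
      have "(\<Sum>r<l. a r * a' r) = (\<Sum>r<l. a r + a' r - 1 + b r * b' r)"
        by (rule sum.cong) (auto simp: b algebra_simps)
      then show ?thesis by (simp add: sum.distrib sa sum_subtractf)
    qed
    have "(\<Sum>r<l. b r * b' r) \<le> 0"
      by (intro sum_nonpos int_mult_nonpos_of_sum_01) (use t in auto)
    moreover have "(\<Sum>r<l. b r * b' r) = 0" if "\<forall>r<l. a r \<in> {0,1}" "\<forall>r<l. a' r \<in> {0,1}"
    proof (rule sum.neutral, rule ballI)
      fix r assume "r \<in> {..<l}"
      then show "b r * b' r = 0" using that t[of r] by (force simp: b)
    qed
    ultimately show ?thesis using False ex by auto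
  qed
  note main = this
  show "(\<Sum>r<l. c r * c' r) \<le> balanced_pairing l v v'"
    unfolding expand target using main by auto
  show "(\<Sum>r<l. c r * c' r) = balanced_pairing l v v'"
    if "\<And>r. r < l \<Longrightarrow> c r \<in> {int (v div l), int (v div l) + 1}"
       "\<And>r. r < l \<Longrightarrow> c' r \<in> {int (v' div l), int (v' div l) + 1}"
  proof -
    have "a r \<in> {0,1}" "a' r \<in> {0,1}" if "r < l" for r
      using that \<open>\<And>r. r < l \<Longrightarrow> c r \<in> _\<close>[of r] \<open>\<And>r. r < l \<Longrightarrow> c' r \<in> _\<close>[of r]
      by (auto simp: a qp)
    then show ?thesis unfolding expand target using main by auto
  qed
qed

definition window_pairs :: "nat \<Rightarrow> nat \<Rightarrow> nat set \<Rightarrow> nat \<Rightarrow> (nat \<times> nat) set" where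
  "window_pairs l k X w =
     {(a, b). a \<in> X \<inter> {w..<w+k} \<and> b \<in> {w..<w+k} - X \<and> a mod l = b mod l}"

lemma card_window_pairs:
  assumes "l > 0"
  shows "card (window_pairs l k X w) =
    (\<Sum>r<l. residue_count l (X \<inter> {w..<w+k}) r * residue_count l ({w..<w+k} - X) r)"
  unfolding window_pairs_def by (rule card_congruent_pairs) (use assms in auto)

lemma sum_tent_eq:
  fixes g :: "'a \<Rightarrow> nat"
  assumes "finite S"
  shows "(\<Sum>p\<in>S. k - g p) = (\<Sum>d<k. (k - d) * card {p \<in> S. g p = d})"
proof -
  have "(\<Sum>p\<in>S. k - g p) = (\<Sum>p\<in>S. \<Sum>d<k. if g p = d then k - d else 0)"
    by (rule sum.cong) (auto simp: sum.delta)
  also have "\<dots> = (\<Sum>d<k. \<Sum>p\<in>S. if g p = d then k - d else 0)" by (rule sum.swap)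
  also have "\<dots> = (\<Sum>d<k. (k - d) * card {p \<in> S. g p = d})"
    by (rule sum.cong) (auto simp: sum.If_cases assms Int_def mult.commute)
  finally show ?thesis .
qed

text \<open>
  Exchanging the roles of members and non-members changes the count by \<open>d\<close>, because \<open>X\<close> contains
  the first \<open>d\<close> numbers.
\<close>

lemma card_up_steps:
  fixes X :: "nat set"
  assumes "finite X" "{..<d} \<subseteq> X"
  shows "card {a \<in> X. a + d \<notin> X} = d + card {b. b \<notin> X \<and> b + d \<in> X}"
proof -
  have "card {a \<in> X. a + d \<notin> X} + card {a \<in> X. a + d \<in> X} = card X"
    using assms(1) by (subst card_Un_disjoint[symmetric]) (auto intro!: arg_cong[where f = card])
  moreover have "card {b. b \<notin> X \<and> b + d \<in> X} + card {a \<in> X. a + d \<in> X} = card {x \<in> X. d \<le> x}"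
  proof -
    have "card {b. b \<notin> X \<and> b + d \<in> X} = card {x \<in> X. d \<le> x \<and> x - d \<notin> X}"
      by (rule bij_betw_same_card[of "\<lambda>b. b + d"], rule bij_betw_byWitness[of _ "\<lambda>x. x - d"]) auto
    moreover have "card {a \<in> X. a + d \<in> X} = card {x \<in> X. d \<le> x \<and> x - d \<in> X}"
      by (rule bij_betw_same_card[of "\<lambda>b. b + d"], rule bij_betw_byWitness[of _ "\<lambda>x. x - d"]) auto
    moreover have "card {x \<in> X. d \<le> x \<and> x - d \<notin> X} + card {x \<in> X. d \<le> x \<and> x - d \<in> X} = card {x \<in> X. d \<le> x}"
      using assms(1) by (subst card_Un_disjoint[symmetric]) (auto intro!: arg_cong[where f = card])
    ultimately show ?thesis by simp
  qed
  moreover have "card X = d + card {x \<in> X. d \<le> x}"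
  proof -
    have "X = {..<d} \<union> {x \<in> X. d \<le> x}" using assms(2) by auto
    then have "card X = card ({..<d} \<union> {x \<in> X. d \<le> x})" by simp
    also have "\<dots> = d + card {x \<in> X. d \<le> x}" using assms(1) by (subst card_Un_disjoint) auto
    finally show ?thesis .
  qed
  ultimately show ?thesis by simp
qed

lemma card_windows_containing:
  fixes a b :: nat
  assumes "a \<le> b" "k \<le> b" "a \<le> N"
  shows "card {w \<in> {..N}. a \<in> {w..<w+k} \<and> b \<in> {w..<w+k}} = k - (b - a)"
proof -
  have "{w \<in> {..N}. a \<in> {w..<w+k} \<and> b \<in> {w..<w+k}} = {Suc b - k..<Suc a}"
    using assms by auto
  then show ?thesis using assms by auto
qed

text \<open>
  A pair at distance \<open>d < k\<close> lies in \<open>k - d\<close> windows.  The pairs with \<open>a > b\<close> are the inversions;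
  those with \<open>a < b\<close> are related to them by \<open>card_up_steps\<close>.  The correction term depends on \<open>k\<close> and
  \<open>l\<close> only, which makes the sums over windows comparable for different sets.
\<close>

lemma sum_card_window_pairs:
  assumes X: "{..<k} \<subseteq> X" "X \<subseteq> {..<N}" 
  shows "(\<Sum>w\<le>N. card (window_pairs l k X w)) =
    2 * (\<Sum>(a, b) \<in> {(a, b) \<in> inversions X. a mod l = b mod l}. k - (a - b))
    + (\<Sum>d | d < k \<and> l dvd d. d * (k - d))"
proof -
  have fX: "finite X" using X(2) finite_subset by blast
  define S where "S = {(a, b). a \<in> X \<and> b \<in> {..<N+k} - X \<and> a mod l = b mod l}"
  define U where "U = {(a, b) \<in> S. b < a}"
  define L where "L = {(a, b) \<in> S. a < b}"
  have fS: "finite S" by (rule finite_subset[of _ "X \<times> {..<N+k}"]) (auto simp: S_def fX)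
  then have fUL: "finite U" "finite L" by (auto simp: U_def L_def elim: finite_subset[rotated])
  have SUL: "S = U \<union> L" "U \<inter> L = {}" by (auto simp: U_def L_def S_def) (metis linorder_neqE_nat)
  have "(\<Sum>w\<le>N. card (window_pairs l k X w)) = (\<Sum>w\<le>N. \<Sum>(a, b)\<in>S. if a \<in> {w..<w+k} \<and> b \<in> {w..<w+k} then 1 else 0)"
  proof (rule sum.cong[OF refl])
    fix w assume w: "w \<in> {..N}"
    have "window_pairs l k X w = {p \<in> S. fst p \<in> {w..<w+k} \<and> snd p \<in> {w..<w+k}}"
      using w by (auto simp: window_pairs_def S_def)
    then show "card (window_pairs l k X w) = (\<Sum>(a, b)\<in>S. if a \<in> {w..<w+k} \<and> b \<in> {w..<w+k} then 1 else 0)"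
      using fS by (simp add: case_prod_unfold sum.If_cases Int_def)
  qed
  also have "\<dots> = (\<Sum>(a, b)\<in>S. card {w \<in> {..N}. a \<in> {w..<w+k} \<and> b \<in> {w..<w+k}})"
    by (subst sum.swap) (simp add: case_prod_unfold sum.If_cases Int_def)
  also have "\<dots> = (\<Sum>(a, b)\<in>U. card {w \<in> {..N}. a \<in> {w..<w+k} \<and> b \<in> {w..<w+k}})
     + (\<Sum>(a, b)\<in>L. card {w \<in> {..N}. a \<in> {w..<w+k} \<and> b \<in> {w..<w+k}})"
    unfolding SUL(1) by (rule sum.union_disjoint) (use fUL SUL in auto)
  also have "(\<Sum>(a, b)\<in>U. card {w \<in> {..N}. a \<in> {w..<w+k} \<and> b \<in> {w..<w+k}}) = (\<Sum>(a, b)\<in>U. k - (a - b))"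
  proof (rule sum.cong[OF refl], clarify)
    fix a b assume ab: "(a, b) \<in> U"
    then have "b < a" "\<not> b < k" "b \<le> N" using X by (auto simp: U_def S_def)
    then have "card {w \<in> {..N}. b \<in> {w..<w+k} \<and> a \<in> {w..<w+k}} = k - (a - b)"
      by (intro card_windows_containing) auto
    then show "card {w \<in> {..N}. a \<in> {w..<w+k} \<and> b \<in> {w..<w+k}} = k - (a - b)"
      by (simp add: conj_commute)
  qed
  also have "(\<Sum>(a, b)\<in>L. card {w \<in> {..N}. a \<in> {w..<w+k} \<and> b \<in> {w..<w+k}}) = (\<Sum>(a, b)\<in>L. k - (b - a))"
  proof (rule sum.cong[OF refl], clarify)
    fix a b assume ab: "(a, b) \<in> L"
    then have "a < b" "\<not> b < k" "a \<le> N" using X by (auto simp: L_def S_def)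
    then show "card {w \<in> {..N}. a \<in> {w..<w+k} \<and> b \<in> {w..<w+k}} = k - (b - a)"
      by (intro card_windows_containing) auto
  qed
  also have U: "U = {(a, b) \<in> inversions X. a mod l = b mod l}"
    using X(2) by (auto simp: U_def S_def inversions_def)
  also have "(\<Sum>(a, b)\<in>L. k - (b - a)) = (\<Sum>(a, b)\<in>U. k - (a - b)) + (\<Sum>d | d < k \<and> l dvd d. d * (k - d))"
  proof -
    have modd: "(a + d) mod l = a mod l \<longleftrightarrow> l dvd d" for a d :: nat
      using mod_eq_dvd_iff_nat[of a "a + d" l] by simp
    have cL: "card {p \<in> L. snd p - fst p = d} = (if l dvd d then card {a \<in> X. a + d \<notin> X} else 0)" if "d < k" for d
    proof (cases "l dvd d")
      case True
      have "{p \<in> L. snd p - fst p = d} = (\<lambda>a. (a, a + d)) ` {a \<in> X. a + d \<notin> X}"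
      proof (intro equalityI subsetI)
        fix p assume "p \<in> {p \<in> L. snd p - fst p = d}"
        then have "fst p \<in> X" "snd p \<notin> X" "snd p = fst p + d" by (auto simp: L_def S_def)
        then show "p \<in> (\<lambda>a. (a, a + d)) ` {a \<in> X. a + d \<notin> X}"
          by (auto simp: image_iff prod_eq_iff)
      next
        fix p assume "p \<in> (\<lambda>a. (a, a + d)) ` {a \<in> X. a + d \<notin> X}"
        then obtain a where a: "p = (a, a + d)" "a \<in> X" "a + d \<notin> X" by auto
        then have "a < N" "d \<noteq> 0" using X by (auto intro!: Nat.gr0I)
        then show "p \<in> {p \<in> L. snd p - fst p = d}"
          using a that True modd[of a d] by (simp add: L_def S_def)
      qed
      then show ?thesis using True by (simp add: card_image inj_on_def)
    next
      case False
      have "{p \<in> L. snd p - fst p = d} = {}"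
      proof -
        have "snd p - fst p \<noteq> d" if "p \<in> L" for p
        proof
          assume "snd p - fst p = d"
          then have "snd p = fst p + d" "snd p mod l = fst p mod l" using that by (auto simp: L_def S_def)
          then show False using modd[of "fst p" d] False by simp
        qed
        then show ?thesis by auto
      qed
      then show ?thesis using False by (simp only: card.empty if_False)
    qed
    have cU: "card {p \<in> U. fst p - snd p = d} = (if l dvd d then card {b. b \<notin> X \<and> b + d \<in> X} else 0)" if "d < k" for d
    proof (cases "l dvd d")
      case True
      have "{p \<in> U. fst p - snd p = d} = (\<lambda>b. (b + d, b)) ` {b. b \<notin> X \<and> b + d \<in> X}"
      proof (intro equalityI subsetI)
        fix p assume "p \<in> {p \<in> U. fst p - snd p = d}"
        then have "fst p \<in> X" "snd p \<notin> X" "fst p = snd p + d" by (auto simp: U_def S_def)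
        then show "p \<in> (\<lambda>b. (b + d, b)) ` {b. b \<notin> X \<and> b + d \<in> X}"
          by (auto simp: image_iff prod_eq_iff)
      next
        fix p assume "p \<in> (\<lambda>b. (b + d, b)) ` {b. b \<notin> X \<and> b + d \<in> X}"
        then obtain b where b: "p = (b + d, b)" "b \<notin> X" "b + d \<in> X" by auto
        then have "b + d < N" "d \<noteq> 0" using X by (auto intro!: Nat.gr0I)
        then show "p \<in> {p \<in> U. fst p - snd p = d}"
          using b that True modd[of b d] by (simp add: U_def S_def)
      qed
      then show ?thesis using True by (simp add: card_image inj_on_def)
    next
      case False
      have "{p \<in> U. fst p - snd p = d} = {}"
      proof -
        have "fst p - snd p \<noteq> d" if "p \<in> U" for p
        proof
          assume "fst p - snd p = d"
          then have "fst p = snd p + d" "fst p mod l = snd p mod l" using that by (auto simp: U_def S_def)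
          then show False using modd[of "snd p" d] False by simp
        qed
        then show ?thesis by auto
      qed
      then show ?thesis using False by (simp only: card.empty if_False)
    qed
    have "(\<Sum>(a, b)\<in>L. k - (b - a)) = (\<Sum>d<k. (k - d) * card {p \<in> L. snd p - fst p = d})"
      using sum_tent_eq[OF fUL(2), of k "\<lambda>p. snd p - fst p"] by (simp add: case_prod_unfold)
    also have "\<dots> = (\<Sum>d<k. (k - d) * card {p \<in> U. fst p - snd p = d} + (if l dvd d then d * (k - d) else 0))"
    proof (rule sum.cong[OF refl])
      fix d assume "d \<in> {..<k}"
      then have d: "d < k" "{..<d} \<subseteq> X" using X(1) by auto
      show "(k - d) * card {p \<in> L. snd p - fst p = d} =
        (k - d) * card {p \<in> U. fst p - snd p = d} + (if l dvd d then d * (k - d) else 0)"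
        by (simp add: cL[OF d(1)] cU[OF d(1)] card_up_steps[OF fX d(2)] distrib_left)
    qed
    also have "\<dots> = (\<Sum>(a, b)\<in>U. k - (a - b)) + (\<Sum>d<k. if l dvd d then d * (k - d) else 0)"
      using sum_tent_eq[OF fUL(1), of k "\<lambda>p. fst p - snd p"] by (simp add: case_prod_unfold sum.distrib)
    also have "(\<Sum>d<k. if l dvd d then d * (k - d) else 0) = (\<Sum>d | d < k \<and> l dvd d. d * (k - d))"
      by (simp add: sum.If_cases Int_def)
    finally show ?thesis .
  qed
  finally show ?thesis by (simp add: U)
qed

text \<open>
  The count falls from \<open>k\<close> in the first window to \<open>0\<close> in the last one, in steps of size at most one.
\<close>

lemma window_count_attains:
  assumes X: "{..<k} \<subseteq> X" "X \<subseteq> {..<N}" and "v \<le> k"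
  shows "\<exists>w\<le>N. card (X \<inter> {w..<w+k}) = v"
proof -
  define f where "f w = - int (card (X \<inter> {w..<w+k}))" for w
  have "\<bar>f (i + 1) - f i\<bar> \<le> 1" for i
  proof -
    let ?A = "X \<inter> {i..<i+k}" and ?B = "X \<inter> {Suc i..<Suc i+k}"
    have "card ?A \<le> card (insert i ?B)" by (rule card_mono) auto
    moreover have "card ?B \<le> card (insert (i + k) ?A)" by (rule card_mono) auto
    ultimately show ?thesis
      by (auto simp: f_def card_insert_if split: if_splits)
  qed
  moreover have "f 0 = - int k"
  proof -
    have "X \<inter> {0..<0+k} = {..<k}" using X(1) by auto
    then show ?thesis by (simp add: f_def)
  qed
  moreover have "f N = 0"
  proof -
    have "X \<inter> {N..<N+k} = {}" using X(2) by auto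
    then show ?thesis unfolding f_def by simp
  qed
  ultimately have "\<exists>w\<le>N. f w = - int v"
    using assms(3) by (intro nat0_intermed_int_val) auto
  then show ?thesis by (auto simp: f_def)
qed

lemma window_pairs_le:
  assumes "l > 0"
  shows "int (card (window_pairs l k X w)) \<le> balanced_pairing l (card (X \<inter> {w..<w+k})) (k - card (X \<inter> {w..<w+k}))"
    and "card (window_pairs 1 k X w) = card (X \<inter> {w..<w+k}) * (k - card (X \<inter> {w..<w+k}))"
proof -
  let ?A = "X \<inter> {w..<w+k}" and ?B = "{w..<w+k} - X"
  have AB: "?A \<union> ?B = {w..<w+k}" "?A \<inter> ?B = {}" by auto
  have cAB: "card ?A + card ?B = k"
    using card_Un_disjoint[of ?A ?B] AB by simp
  then have kB: "k - card ?A = card ?B" by simp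
  have r: "residue_count l ?A r + residue_count l ?B r \<in> {k div l, k div l + 1}" if "r < l" for r
    using residue_count_interval[OF that, of w k] residue_count_Un_disjoint[of ?A ?B l r] AB by simp
  have "(\<Sum>r<l. int (residue_count l ?A r) * int (residue_count l ?B r)) \<le> balanced_pairing l (card ?A) (card ?B)"
  proof (rule sum_mult_le_balanced_pairing[OF assms])
    show "int (residue_count l ?A r) + int (residue_count l ?B r) \<in>
      {int ((card ?A + card ?B) div l), int ((card ?A + card ?B) div l) + 1}" if "r < l" for r
      using r[OF that] cAB by auto
  qed (use assms in \<open>simp_all add: sum_residue_count flip: of_nat_sum\<close>)
  then show "int (card (window_pairs l k X w)) \<le> balanced_pairing l (card ?A) (k - card ?A)"
    unfolding kB card_window_pairs[OF assms] by simp
  have "card (window_pairs 1 k X w) = card ?A * card ?B"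
    by (simp add: card_window_pairs residue_count_one)
  then show "card (window_pairs 1 k X w) = card ?A * (k - card ?A)"
    unfolding kB .
qed

text \<open>
  For the initial segment, both the members and the non-members in a window are intervals, so they
  attain equality in \<open>window_pairs_le\<close>.
\<close>

lemma window_pairs_ground:
  assumes "l > 0" "v \<le> k"
  shows "int (card (window_pairs l k {..<k} (k - v))) = balanced_pairing l v (k - v)"
    and "card (window_pairs 1 k {..<k} (k - v)) = v * (k - v)"
proof -
  have A: "{..<k} \<inter> {k - v..<k - v + k} = {k - v..<k - v + v}"
    and B: "{k - v..<k - v + k} - {..<k} = {k..<k + (k - v)}" using assms by auto
  show "card (window_pairs 1 k {..<k} (k - v)) = v * (k - v)"
    unfolding window_pairs_le(2)[OF assms(1)] A by simp
  have r: "residue_count l {k - v..<k - v + v} r + residue_count l {k..<k + (k - v)} r \<in> {k div l, k div l + 1}" 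
    if "r < l" for r
  proof -
    have "{k - v..<k - v + v} \<union> {k..<k + (k - v)} = {k - v..<k - v + k}" using assms by auto
    then show ?thesis
      using residue_count_interval[OF that, of "k - v" k] 
        residue_count_Un_disjoint[of "{k - v..<k - v + v}" "{k..<k + (k - v)}" l r] assms by simp
  qed
  have "(\<Sum>r<l. int (residue_count l {k - v..<k - v + v} r) * int (residue_count l {k..<k + (k - v)} r)) = balanced_pairing l v (k - v)"
  proof (rule sum_mult_le_balanced_pairing(2)[OF assms(1)])
    show "int (residue_count l {k - v..<k - v + v} r) + int (residue_count l {k..<k + (k - v)} r) \<in>
      {int ((v + (k - v)) div l), int ((v + (k - v)) div l) + 1}" if "r < l" for r
      using r[OF that] assms by auto
    show "int (residue_count l {k - v..<k - v + v} r) \<in> {int (v div l), int (v div l) + 1}" if "r < l" for r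
      using residue_count_interval[OF that, of "k - v" v] by auto
    show "int (residue_count l {k..<k + (k - v)} r) \<in> {int ((k - v) div l), int ((k - v) div l) + 1}" if "r < l" for r
      using residue_count_interval[OF that, of k "k - v"] by auto
  qed (use assms in \<open>simp_all add: sum_residue_count flip: of_nat_sum\<close>)
  then show "int (card (window_pairs l k {..<k} (k - v))) = balanced_pairing l v (k - v)"
    unfolding card_window_pairs[OF assms(1)] A B by simp
qed

section \<open>The hook product inequality\<close>

text \<open>
  By \<open>sum_card_window_pairs\<close>, twice the difference of the two sides is the sum of the defects \<open>D X w\<close>
  of all windows of \<open>X\<close>, minus the same sum for the initial segment.  All defects are nonnegative,
  and a window of \<open>X\<close> with \<open>v\<close> members has at least the defect of the window of the initial segment
  with \<open>v\<close> members.
\<close>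

lemma tent_sum_inversions_of_prefix:
  assumes X: "{..<k} \<subseteq> X" "X \<subseteq> {..<N}" and l: "l > 0"
  shows "l * (\<Sum>(a, b) \<in> {(a, b) \<in> inversions X. a mod l = b mod l}. k - (a - b))
    \<le> (\<Sum>(a, b) \<in> inversions X. k - (a - b))"
proof -
  define I where "I l = (\<Sum>(a, b) \<in> {(a, b) \<in> inversions X. a mod l = b mod l}. k - (a - b))" for l
  define D where "D Y w = int (card (window_pairs 1 k Y w)) - int l * int (card (window_pairs l k Y w))" for Y w
  have tot: "(\<Sum>w\<le>N. card (window_pairs l k X w)) = 2 * I l + (\<Sum>w\<le>k. card (window_pairs l k {..<k} w))" for l
  proof -
    have "inversions {..<k} = {}" by (auto simp: inversions_def)
    then have e: "{(a, b) \<in> inversions {..<k}. a mod l = b mod l} = {}" by auto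
    have "(\<Sum>w\<le>k. card (window_pairs l k {..<k} w)) = (\<Sum>d | d < k \<and> l dvd d. d * (k - d))"
      using sum_card_window_pairs[of k "{..<k}" k l] unfolding e by simp
    then show ?thesis
      unfolding I_def using sum_card_window_pairs[OF X, of l] by linarith
  qed
  have sumD: "(\<Sum>w\<le>N. D X w) = 2 * (int (I 1) - int l * int (I l)) + (\<Sum>w\<le>k. D {..<k} w)"
  proof -
    have *: "(\<Sum>w\<in>A. D Y w) = int (\<Sum>w\<in>A. card (window_pairs 1 k Y w)) - int l * int (\<Sum>w\<in>A. card (window_pairs l k Y w))" for A Y
      by (simp add: D_def sum_subtractf sum_distrib_left)
    show ?thesis unfolding * tot by (simp add: algebra_simps)
  qed
  \<comment> \<open>h v is a window with v members; distinct v give distinct windows\<close>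
  obtain h where h: "\<And>v. v \<le> k \<Longrightarrow> h v \<le> N \<and> card (X \<inter> {h v..<h v+k}) = v"
    using window_count_attains[OF X] by metis
  have inj: "inj_on h {..k}"
    by (rule inj_on_inverseI[of _ "\<lambda>w. card (X \<inter> {w..<w+k})"]) (use h in auto)
  have nonneg: "D X w \<ge> 0" for w
  proof -
    let ?v = "card (X \<inter> {w..<w+k})"
    have "int l * int (card (window_pairs l k X w)) \<le> int l * balanced_pairing l ?v (k - ?v)"
      by (intro mult_left_mono window_pairs_le l) auto
    also have "\<dots> \<le> int (?v * (k - ?v))" by (rule balanced_pairing_le[OF l])
    finally show ?thesis using window_pairs_le(2)[OF l, of k X w] by (simp add: D_def)
  qed
  have "(\<Sum>w\<le>k. D {..<k} w) = (\<Sum>v\<le>k. D {..<k} (k - v))"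
    by (rule sum.reindex_bij_witness[of _ "\<lambda>v. k - v" "\<lambda>v. k - v"]) auto
  also have "\<dots> \<le> (\<Sum>v\<le>k. D X (h v))"
  proof (rule sum_mono)
    fix v assume "v \<in> {..k}"
    then have v: "v \<le> k" by simp
    have "int l * int (card (window_pairs l k X (h v))) \<le> int l * int (card (window_pairs l k {..<k} (k - v)))"
      using window_pairs_le(1)[OF l, of k X "h v"] h[OF v] window_pairs_ground(1)[OF l v]
      by (intro mult_left_mono) auto
    then show "D {..<k} (k - v) \<le> D X (h v)"
      using window_pairs_le(2)[OF l, of k X "h v"] h[OF v] window_pairs_ground(2)[OF l v]
      by (simp add: D_def)
  qed
  also have "\<dots> = (\<Sum>w\<in>h ` {..k}. D X w)" by (simp add: sum.reindex[OF inj])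
  also have "\<dots> \<le> (\<Sum>w\<le>N. D X w)" by (rule sum_mono2) (use h nonneg in auto)
  finally have "int l * int (I l) \<le> int (I 1)" using sumD by simp
  then have "l * I l \<le> I 1" by (simp flip: of_nat_mult)
  then show ?thesis by (simp add: I_def)
qed

text \<open>
  Shift \<open>X\<close> by \<open>k\<close> and fill the gap: this does not affect the inversions.
\<close>

lemma tent_sum_inversions:
  assumes "finite X" and l: "l > 0"
  shows "l * (\<Sum>(a, b) \<in> {(a, b) \<in> inversions X. a mod l = b mod l}. k - (a - b))
    \<le> (\<Sum>(a, b) \<in> inversions X. k - (a - b))"
proof -
  \<comment> \<open>the first k numbers become members, which the window argument needs\<close>
  define Y where "Y = {..<k} \<union> (\<lambda>x. x + k) ` X"
  have "finite Y" using assms(1) by (simp add: Y_def)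
  then obtain N where "\<forall>y\<in>Y. y < N" using finite_nat_set_iff_bounded by auto
  then have N: "Y \<subseteq> {..<N}" by auto
  have inv: "inversions Y = (\<lambda>(a, b). (a + k, b + k)) ` inversions X" 
  proof (intro equalityI subsetI)
    fix p assume "p \<in> inversions Y"
    then obtain a b where p: "p = (a, b)" "a \<in> Y" "b \<notin> Y" "b < a" by (auto simp: inversions_def)
    then have "\<not> b < k" by (auto simp: Y_def)
    then have "a - k \<in> X" "b - k \<notin> X" "b - k < a - k" "p = (a - k + k, b - k + k)"
      using p by (auto simp: Y_def image_iff)
    then show "p \<in> (\<lambda>(a, b). (a + k, b + k)) ` inversions X"
      by (auto simp: inversions_def image_iff)
  qed (auto simp: inversions_def Y_def)
  have inj: "inj_on (\<lambda>(a, b). (a + k, b + k)) S" for S :: "(nat \<times> nat) set" by (auto simp: inj_on_def)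
  have modk: "(a + k) mod l = (b + k) mod l \<longleftrightarrow> a mod l = b mod l" if "b < a" for a b
    using mod_eq_dvd_iff_nat[of b a l] mod_eq_dvd_iff_nat[of "b + k" "a + k" l] that by simp
  have 1: "(\<Sum>(a, b) \<in> inversions Y. k - (a - b)) = (\<Sum>(a, b) \<in> inversions X. k - (a - b))"
    unfolding inv sum.reindex[OF inj] by (simp add: case_prod_unfold)
  have "{(a, b) \<in> inversions Y. a mod l = b mod l} = (\<lambda>(a, b). (a + k, b + k)) ` {(a, b) \<in> inversions X. a mod l = b mod l}"
    unfolding inv by (auto simp: modk inversions_def)
  then have 2: "(\<Sum>(a, b) \<in> {(a, b) \<in> inversions Y. a mod l = b mod l}. k - (a - b)) =
     (\<Sum>(a, b) \<in> {(a, b) \<in> inversions X. a mod l = b mod l}. k - (a - b))"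
    by (simp only: sum.reindex[OF inj]) (simp add: case_prod_unfold)
  show ?thesis using tent_sum_inversions_of_prefix[of k Y N l] N l unfolding 1 2 by (simp add: Y_def)
qed

text \<open>
  The coefficients are the negated second differences of \<open>ln\<close>; the last tent accounts for the slope
  at the end.
\<close>

lemma ln_eq_tent_combination:
  assumes "1 \<le> h" "h \<le> N"
  shows "ln (real (N + 1)) - ln (real h) =
    (\<Sum>k=2..N. (2 * ln (real k) - ln (real (k - 1)) - ln (real (k + 1))) * real (k - h))
      + (ln (real (N + 1)) - ln (real N)) * real (N + 1 - h)"
  using assms(2)
proof (induction N rule: dec_induct)
  case base
  have "(\<Sum>k=2..h. (2 * ln (real k) - ln (real (k - 1)) - ln (real (k + 1))) * real (k - h)) = 0"
    by (rule sum.neutral) auto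
  then show ?case by simp
next
  case (step N)
  have N: "1 \<le> N" using step assms by simp
  have "(\<Sum>k=2..Suc N. (2 * ln (real k) - ln (real (k - 1)) - ln (real (k + 1))) * real (k - h)) =
    (\<Sum>k=2..N. (2 * ln (real k) - ln (real (k - 1)) - ln (real (k + 1))) * real (k - h))
      + (2 * ln (real (Suc N)) - ln (real N) - ln (real (Suc N + 1))) * real (Suc N - h)"
    using N by simp
  moreover have "real (Suc N + 1 - h) = real (Suc N - h) + 1" "real (N + 1 - h) = real (Suc N - h)"
    using step by (auto simp: of_nat_diff)
  ultimately show ?case using step.IH by (simp add: algebra_simps)
qed

text \<open>
  Take logarithms and expand \<open>ln (N + 1) - ln h\<close> into tents; by the hypothesis on the cardinalities,
  the constant \<open>ln (N + 1)\<close> contributes the same to both sides.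
\<close>

lemma prod_le_power_prod_of_tents:
  fixes g :: "'a \<Rightarrow> nat"
  assumes fin: "finite S" "S' \<subseteq> S"
    and pos: "\<And>p. p \<in> S \<Longrightarrow> g p \<ge> 1"
    and card: "card S = l * card S'"
    and tents: "\<And>k. l * (\<Sum>p\<in>S'. k - g p) \<le> (\<Sum>p\<in>S. k - g p)"
  shows "(\<Prod>p\<in>S. g p) \<le> (\<Prod>p\<in>S'. g p) ^ l"
proof -
  have fin': "finite S'" using fin finite_subset by blast
  obtain N where N: "\<And>p. p \<in> S \<Longrightarrow> g p \<le> N" "N \<ge> 1"
  proof
    show "g p \<le> Max (insert 1 (g ` S))" if "p \<in> S" for p using that fin by simp
    show "Max (insert 1 (g ` S)) \<ge> 1" using fin by simp
  qed
  define c where "c k = 2 * ln (real k) - ln (real (k - 1)) - ln (real (k + 1))" for k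
  define d where "d = ln (real (N + 1)) - ln (real N)"
  define G where "G A k = (\<Sum>p\<in>A. real (k - g p))" for A k
  have d: "d \<ge> 0" using N(2) by (simp add: d_def)
  have c: "c k \<ge> 0" if "k \<ge> 2" for k
  proof -
    have "real (k - 1) * real (k + 1) \<le> real k ^ 2"
      using that by (simp add: of_nat_diff power2_eq_square algebra_simps)
    then have "ln (real (k - 1) * real (k + 1)) \<le> ln (real k ^ 2)"
      using that by (subst ln_le_cancel_iff) auto
    then show ?thesis using that by (simp add: c_def ln_mult ln_realpow)
  qed
  have expand: "(\<Sum>p\<in>A. ln (real (N + 1)) - ln (real (g p))) = (\<Sum>k=2..N. c k * G A k) + d * G A (N + 1)"
    if "A \<subseteq> S" for A
  proof -
    have "(\<Sum>p\<in>A. ln (real (N + 1)) - ln (real (g p))) =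
      (\<Sum>p\<in>A. (\<Sum>k=2..N. c k * real (k - g p)) + d * real (N + 1 - g p))"
      using that by (intro sum.cong refl) (auto simp only: c_def d_def intro!: ln_eq_tent_combination pos N)
    also have "\<dots> = (\<Sum>k=2..N. \<Sum>p\<in>A. c k * real (k - g p)) + d * G A (N + 1)"
      by (simp add: sum.distrib sum_distrib_left G_def) (rule sum.swap)
    finally show ?thesis by (simp add: G_def sum_distrib_left)
  qed
  have GG: "real l * G S' k \<le> G S k" for k
  proof -
    have "real (l * (\<Sum>p\<in>S'. k - g p)) \<le> real (\<Sum>p\<in>S. k - g p)" using tents by (rule of_nat_mono)
    then show ?thesis by (simp add: G_def)
  qed
  have "real l * (\<Sum>p\<in>S'. ln (real (N + 1)) - ln (real (g p))) =
     (\<Sum>k=2..N. c k * (real l * G S' k)) + d * (real l * G S' (N + 1))"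
    unfolding expand[OF fin(2)] by (simp add: distrib_left sum_distrib_left mult_ac)
  also have "\<dots> \<le> (\<Sum>k=2..N. c k * G S k) + d * G S (N + 1)"
    by (intro add_mono sum_mono mult_left_mono GG c d) auto
  also have "\<dots> = (\<Sum>p\<in>S. ln (real (N + 1)) - ln (real (g p)))"
    by (rule expand[OF order.refl, symmetric])
  finally have "(\<Sum>p\<in>S. ln (real (g p))) \<le> real l * (\<Sum>p\<in>S'. ln (real (g p)))"
    by (simp add: sum_subtractf card algebra_simps)
  moreover have pS: "real (\<Prod>p\<in>A. g p) > 0" "ln (real (\<Prod>p\<in>A. g p)) = (\<Sum>p\<in>A. ln (real (g p)))" if "A \<subseteq> S" for A
  proof -
    have fA: "finite A" using that fin(1) finite_subset by blast
    have A: "real (g p) > 0" if "p \<in> A" for p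
      using that \<open>A \<subseteq> S\<close> pos[of p] by auto
    then show "real (\<Prod>p\<in>A. g p) > 0" by (simp add: prod_pos)
    show "ln (real (\<Prod>p\<in>A. g p)) = (\<Sum>p\<in>A. ln (real (g p)))"
      unfolding of_nat_prod by (rule ln_prod) (use fA A in \<open>auto dest: A\<close>)
  qed
  ultimately have "ln (real (\<Prod>p\<in>S. g p)) \<le> ln (real (\<Prod>p\<in>S'. g p) ^ l)"
    using pS[OF fin(2)] pS[of S] by (simp only: ln_realpow order.refl)
  then have "real (\<Prod>p\<in>S. g p) \<le> real (\<Prod>p\<in>S'. g p) ^ l"
    using pS[OF fin(2)] pS[of S] by (subst (asm) ln_le_cancel_iff) auto
  then show ?thesis by (simp only: flip: of_nat_power)
qed

lemma hook_product_inequality: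
  assumes "finite X" "l > 0"
    and "card (inversions X) = l * card {(a, b) \<in> inversions X. a mod l = b mod l}"
  shows "(\<Prod>(a, b) \<in> inversions X. a - b) \<le> (\<Prod>(a, b) \<in> {(a, b) \<in> inversions X. a mod l = b mod l}. a - b) ^ l"
proof -
  have "(\<Prod>p \<in> inversions X. fst p - snd p) \<le> (\<Prod>p \<in> {p \<in> inversions X. fst p mod l = snd p mod l}. fst p - snd p) ^ l"
  proof (rule prod_le_power_prod_of_tents)
    show "card (inversions X) = l * card {p \<in> inversions X. fst p mod l = snd p mod l}"
      using assms(3) by (simp add: case_prod_unfold)
    show "l * (\<Sum>p \<in> {p \<in> inversions X. fst p mod l = snd p mod l}. k - (fst p - snd p)) \<le> (\<Sum>p \<in> inversions X. k - (fst p - snd p))" for k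
      using tent_sum_inversions[OF assms(1,2), of k] by (simp add: case_prod_unfold)
    show "finite (inversions X)" by (rule finite_inversions[OF assms(1)])
    show "1 \<le> fst p - snd p" if "p \<in> inversions X" for p using that by (auto simp: inversions_def)
  qed auto
  then show ?thesis by (simp add: case_prod_unfold)
qed

section \<open>From the generating polynomial to the residues of the major index\<close>

lemma power_mult_fact_le: "(a + 1) ^ b * fact a \<le> (fact (a + b) :: nat)"
proof (induction b)
  case (Suc b)
  have "(a + 1) ^ Suc b * fact a = (a + 1) * ((a + 1) ^ b * fact a)" by (simp only: power_Suc mult.assoc)
  also have "\<dots> \<le> (a + b + 1) * fact (a + b)" by (intro mult_mono Suc.IH) auto
  finally show ?case by simp
qed simp

lemma fact_add_le: "fact (n + b) \<le> (fact n * fact b * (n + 1) ^ b :: nat)"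
proof (induction b)
  case (Suc b)
  have "fact (n + Suc b) = (n + b + 1) * (fact (n + b) :: nat)" by simp
  also have "\<dots> \<le> ((b + 1) * (n + 1)) * (fact n * fact b * (n + 1) ^ b)"
    by (intro mult_mono Suc.IH) auto
  finally show ?case by (simp add: algebra_simps)
qed simp

text \<open>
  Each factor \<open>(l * i) ^ l\<close> is at most the product of the \<open>l\<close> consecutive numbers starting at
  \<open>l * i\<close>, which compares the left-hand side with \<open>(l * s + l - 1)! / (l - 1)!\<close>.
\<close>

lemma prod_multiples_power_le:
  assumes "l > 0"
  shows "(\<Prod>i=1..s. l * i) ^ l \<le> fact (l * s) * (l * s + 1) ^ (l :: nat)"
proof -
  obtain b where b: "l = Suc b" using assms gr0_conv_Suc by auto
  have "(\<Prod>i=1..s. l * i) ^ l * fact b \<le> (fact (l * s + b) :: nat)"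
  proof (induction s)
    case (Suc s)
    have "(\<Prod>i=1..Suc s. l * i) ^ l * fact b = (l * Suc s) ^ l * ((\<Prod>i=1..s. l * i) ^ l * fact b)"
      by (simp add: power_mult_distrib mult_ac)
    also have "\<dots> \<le> (l * Suc s) ^ l * fact (l * s + b)" by (intro mult_left_mono Suc.IH) auto
    also have "l * Suc s = (l * s + b) + 1" by (simp add: b)
    also have "((l * s + b) + 1) ^ l * fact (l * s + b) \<le> (fact ((l * s + b) + l) :: nat)"
      by (rule power_mult_fact_le)
    also have "(l * s + b) + l = l * Suc s + b" by simp
    finally show ?case .
  qed simp
  also have "\<dots> \<le> fact (l * s) * fact b * (l * s + 1) ^ b" by (rule fact_add_le)
  finally have "(\<Prod>i=1..s. l * i) ^ l \<le> fact (l * s) * (l * s + 1) ^ b"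
    by (simp add: mult_ac)
  also have "\<dots> \<le> fact (l * s) * (l * s + 1) ^ l" by (simp add: b)
  finally show ?thesis .
qed

lemma root_of_unity_order:
  assumes "(w :: complex) ^ n = 1" "n > 0"
  obtains l where "l > 0" "\<And>k. w ^ k = 1 \<longleftrightarrow> l dvd k"
proof -
  define l where "l = (LEAST l. l > 0 \<and> w ^ l = 1)"
  have l: "l > 0 \<and> w ^ l = 1" unfolding l_def by (rule LeastI[of _ n]) (use assms in auto)
  have "w ^ k = 1 \<longleftrightarrow> l dvd k" for k
  proof
    assume k: "w ^ k = 1"
    have "w ^ k = (w ^ l) ^ (k div l) * w ^ (k mod l)" by (simp flip: power_mult power_add)
    then have "w ^ (k mod l) = 1" using k l by simp
    moreover have "k mod l < l" using l by simp
    ultimately have "k mod l = 0" using not_less_Least[of "k mod l" "\<lambda>l. l > 0 \<and> w ^ l = 1"]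
      by (auto simp flip: l_def)
    then show "l dvd k" by auto
  qed (use l in \<open>auto simp: power_mult elim!: dvdE\<close>)
  then show thesis using that[of l] l by blast
qed

text \<open>
  Combining the value of \<open>norm (maj_poly w lam)\<close>, the hook length formula and the hook product
  inequality gives \<open>norm (maj_poly w lam) ^ l \<le> f * (n + 1) ^ l\<close>.  Since \<open>f \<ge> 1\<close> and
  \<open>l \<ge> 2\<close>, the \<open>l\<close>-th root of \<open>f\<close> is at most its square root.
\<close>

theorem norm_maj_poly_root_of_unity_le:
  assumes sorted: "sorted_wrt (\<ge>) lam" and n: "sum_list lam = n" "length lam = n" "n > 0"
    and w: "w ^ n = 1" "w \<noteq> 1"
  shows "norm (maj_poly w lam) \<le> real (n + 1) * sqrt (real (num_SYT lam))"
proof -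
  let ?f = "num_SYT lam" and ?X = "beta_set lam"
  obtain l where l: "l > 0" and order: "\<And>k. w ^ k = 1 \<longleftrightarrow> l dvd k" using root_of_unity_order[OF w(1) n(3)] by blast
  have "l dvd n" using w(1) order by simp
  then obtain s where s: "n = l * s" by blast
  have "l \<noteq> 1" using order[of 1] w(2) by auto
  then have l2: "l \<ge> 2" using l by simp
  have norm_w: "norm w = 1" using power_eq_1_iff[OF w(1)] n(3) by simp
  have f: "?f \<ge> 1" using num_SYT_pos[OF sorted] by simp
  show ?thesis
  proof (cases "maj_poly w lam = 0")
    case False
    define P where "P = norm (maj_poly w lam)"
    define H where "H = (\<Prod>(a, b)\<in>inversions ?X. a - b)"
    define H' where "H' = (\<Prod>(a, b)\<in>congruent_inversions l ?X. a - b)"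
    have main: "card (inversions ?X) = l * card (congruent_inversions l ?X)" "P * real H' = real (\<Prod>i=1..s. l * i)"
      using norm_maj_poly_mult_prod_congruent[OF norm_w order l sorted _ _ False, of s s] n s by (simp_all add: P_def H'_def)
    have "H \<le> H' ^ l"
      unfolding H_def H'_def by (rule hook_product_inequality[OF finite_beta_set[OF sorted] l main(1)])
    have fH: "?f * H = fact n" using hook_length_formula[OF sorted] by (simp add: H_def n)
    have "P ^ l * real H \<le> P ^ l * real (H' ^ l)"
      using \<open>H \<le> H' ^ l\<close> by (intro mult_left_mono) (auto simp: P_def simp del: of_nat_power)
    also have "\<dots> = real ((\<Prod>i=1..s. l * i) ^ l)" using main(2) by (simp only: of_nat_power flip: power_mult_distrib)
    also have "\<dots> \<le> real (fact n * (n + 1) ^ l)"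
      unfolding s by (intro of_nat_mono prod_multiples_power_le l)
    also have "\<dots> = (real ?f * real (n + 1) ^ l) * real H" by (simp add: fH[symmetric])
    finally have "P ^ l * real H \<le> (real ?f * real (n + 1) ^ l) * real H" .
    moreover have "real H > 0" using fH by (metis fact_nonzero gr0I mult_0_right of_nat_0_less_iff)
    ultimately have "P ^ l \<le> real ?f * real (n + 1) ^ l" by simp
    also have "real ?f \<le> sqrt (real ?f) ^ l"
    proof -
      have "real ?f = sqrt (real ?f) ^ 2" by simp
      also have "\<dots> \<le> sqrt (real ?f) ^ l" using f l2 by (intro power_increasing) auto
      finally show ?thesis .
    qed
    finally have "P ^ l \<le> (real (n + 1) * sqrt (real ?f)) ^ l" by (simp add: power_mult_distrib mult.commute)
    then show ?thesis using l unfolding P_def by (subst (asm) power_mono_iff) auto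
  qed simp
qed

lemma length_le_sum_list: "(\<And>p. p \<in> set lam \<Longrightarrow> p > 0) \<Longrightarrow> length lam \<le> sum_list (lam :: nat list)"
proof (induction lam)
  case (Cons a lam)
  then have "length lam \<le> sum_list lam" "a > 0" by auto
  then show ?case by simp
qed simp

lemma diagram_append_zeros: "diagram (lam @ replicate k 0) = diagram lam"
  by (auto simp: diagram_def nth_append split: if_splits)

lemma sum_roots_of_unity_powers:
  fixes n m r :: nat
  assumes "n > 0"
  defines "z \<equiv> cis (2 * pi / real n)"
  shows "(\<Sum>k<n. (z ^ k) ^ m * cnj (z ^ k) ^ r) = (if m mod n = r mod n then of_nat n else 0)"
proof -
  have zp: "z ^ k = cis (2 * pi * real k / real n)" for k
    by (simp add: z_def DeMoivre mult_ac)
  have zn: "z ^ n = 1" using assms(1) by (simp add: zp)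
  have inj: "inj_on (\<lambda>k. z ^ k) {..<n}"
    unfolding zp using bij_betw_roots_unity[OF assms(1)] by (rule bij_betw_imp_inj_on)
  have zmod: "z ^ m = z ^ (m mod n)" for m
  proof -
    have "z ^ m = z ^ (n * (m div n) + m mod n)" by simp
    also have "\<dots> = z ^ (m mod n)" by (simp only: power_add power_mult zn power_one mult_1)
    finally show ?thesis .
  qed
  have eq: "z ^ m = z ^ r \<longleftrightarrow> m mod n = r mod n"
    using inj_on_eq_iff[OF inj, of "m mod n" "r mod n"] assms(1) zmod[of m] zmod[of r] by simp
  \<comment> \<open>the sum is geometric with ratio u, which is an n-th root of unity\<close>
  define u where "u = z ^ m * cnj z ^ r"
  have zz: "z ^ r * cnj z ^ r = 1"
    by (simp add: z_def cis_cnj cis_mult flip: power_mult_distrib)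
  have "u = 1 \<longleftrightarrow> z ^ m = z ^ r"
  proof
    assume "u = 1"
    then have "z ^ m * (z ^ r * cnj z ^ r) = z ^ r" by (simp add: u_def mult_ac)
    then show "z ^ m = z ^ r" by (simp add: zz)
  qed (simp add: u_def zz)
  then have u1: "u = 1 \<longleftrightarrow> m mod n = r mod n" by (simp add: eq)
  have "u ^ n = (z ^ n) ^ m * (cnj (z ^ n)) ^ r"
    by (simp add: u_def power_mult_distrib mult.commute flip: power_mult)
  then have un: "u ^ n = 1" by (simp add: zn)
  have "(\<Sum>k<n. (z ^ k) ^ m * cnj (z ^ k) ^ r) = (\<Sum>k<n. u ^ k)"
    by (rule sum.cong) (simp_all add: u_def power_mult_distrib mult.commute flip: power_mult)
  also have "\<dots> = (if u = 1 then of_nat n else 0)"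
    using un by (simp add: sum_gp_strict)
  finally show ?thesis by (simp add: u1)
qed

theorem theorem6:
  fixes n :: nat and lam :: "nat list" and r :: int
  assumes "n \<ge> 1" and "lam \<turnstile> n"
  shows "\<bar>real (num_SYT_maj lam r) / real (num_SYT lam) - 1 / real n\<bar>
    \<le> 2 * real n powr (3 / 2) / sqrt (real (num_SYT lam))"
proof -
  have lam: "sorted_wrt (\<ge>) lam" "\<And>p. p \<in> set lam \<Longrightarrow> p > 0" "sum_list lam = n"
    using assms(2) by (auto simp: partition_of_def)
  \<comment> \<open>with exactly n rows, the number of beta-numbers is a multiple of the order of every
      n-th root of unity, as balancedness requires; empty rows leave the tableaux unchanged\<close>
  define mu where "mu = lam @ replicate (n - length lam) 0"
  have "sorted_wrt (\<ge>) (replicate k (0 :: nat))" for k by (induction k) auto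
  then have mu: "sorted_wrt (\<ge>) mu" "sum_list mu = n" "length mu = n"
    using lam length_le_sum_list[of lam] by (auto simp: mu_def sorted_wrt_append sum_list_replicate)
  have diag: "diagram mu = diagram lam" by (simp add: mu_def diagram_append_zeros)
  have SYT: "SYT mu = SYT lam" by (simp add: SYT_def diag mu lam)
  have maj: "maj mu T = maj lam T" for T by (simp add: maj_def descents_def diag mu lam)
  define f where "f = real (num_SYT lam)"
  define N where "N = real (num_SYT_maj lam r)"
  have f: "f \<ge> 1" using num_SYT_pos[OF mu(1)] by (simp add: f_def num_SYT_def SYT)
  define z where "z = cis (2 * pi / real n)"
  define r' where "r' = nat (r mod int n)"
  have n: "n > 0" using assms(1) by simp
  have r': "int r' = r mod int n" using n by (simp add: r'_def)
  have cong: "[int (maj lam T) = r] (mod int (sum_list lam)) \<longleftrightarrow> maj lam T mod n = r' mod n" for T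
  proof -
    have "[int (maj lam T) = r] (mod int (sum_list lam)) \<longleftrightarrow> int (maj lam T mod n) = int (r' mod n)"
      by (simp add: cong_def lam zmod_int r')
    then show ?thesis by (simp only: of_nat_eq_iff)
  qed
  have "(\<Sum>k<n. maj_poly (z ^ k) mu * cnj (z ^ k) ^ r') = (\<Sum>T\<in>SYT lam. \<Sum>k<n. (z ^ k) ^ maj lam T * cnj (z ^ k) ^ r')"
    unfolding maj_poly_def SYT maj sum_distrib_right by (rule sum.swap)
  also have "\<dots> = (\<Sum>T\<in>SYT lam. if maj lam T mod n = r' mod n then of_nat n else 0)"
    unfolding z_def by (intro sum.cong refl sum_roots_of_unity_powers n)
  also have "\<dots> = of_nat n * of_nat (num_SYT_maj lam r)"
    by (simp add: num_SYT_maj_def cong sum.If_cases finite_SYT Int_def mult.commute)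
  finally have filter: "(\<Sum>k<n. maj_poly (z ^ k) mu * cnj (z ^ k) ^ r') = complex_of_real (real n * N)"
    by (simp add: N_def)
  have split: "(\<Sum>k<n. g k) = g 0 + (\<Sum>k=1..<n. g k)" for g :: "nat \<Rightarrow> complex"
    using n by (simp add: sum.atLeast_Suc_lessThan flip: atLeast0LessThan)
  have "maj_poly (z ^ 0) mu * cnj (z ^ 0) ^ r' = complex_of_real f"
    by (simp add: maj_poly_1 f_def num_SYT_def SYT)
  then have diff: "complex_of_real (real n * N - f) = (\<Sum>k=1..<n. maj_poly (z ^ k) mu * cnj (z ^ k) ^ r')"
    using filter split[of "\<lambda>k. maj_poly (z ^ k) mu * cnj (z ^ k) ^ r'"] by simp
  have "\<bar>real n * N - f\<bar> = norm (complex_of_real (real n * N - f))" by (simp only: norm_of_real)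
  also have "\<dots> \<le> (\<Sum>k=1..<n. real (n + 1) * sqrt f)"
    unfolding diff
  proof (rule sum_norm_le)
    fix k assume k: "k \<in> {1..<n}"
    have zp: "z ^ k = cis (2 * pi * real k / real n)" for k
      by (simp add: z_def DeMoivre mult_ac)
    have "z ^ n = 1" unfolding zp using n by simp
    then have "(z ^ k) ^ n = 1" by (metis mult.commute power_mult power_one)
    moreover have "z ^ k \<noteq> 1"
    proof -
      have "z ^ k \<noteq> z ^ 0"
        unfolding zp using bij_betw_imp_inj_on[OF bij_betw_roots_unity[OF n]] k n
        by (subst inj_on_eq_iff) auto
      then show ?thesis by simp
    qed
    ultimately have "norm (maj_poly (z ^ k) mu) \<le> real (n + 1) * sqrt (real (num_SYT mu))"
      by (rule norm_maj_poly_root_of_unity_le[OF mu n])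
    then show "norm (maj_poly (z ^ k) mu * cnj (z ^ k) ^ r') \<le> real (n + 1) * sqrt f"
      by (simp add: norm_mult norm_power z_def f_def num_SYT_def SYT)
  qed
  also have "\<dots> = (real n - 1) * (real n + 1) * sqrt f" using n by (simp add: of_nat_diff)
  also have "\<dots> \<le> real n * real n * sqrt f" using f by (intro mult_right_mono) (auto simp: algebra_simps)
  finally have bound: "\<bar>real n * N - f\<bar> \<le> real n * real n * sqrt f" .
  have "\<bar>N / f - 1 / real n\<bar> = \<bar>real n * N - f\<bar> / (real n * f)"
    using f n by (simp add: field_simps abs_divide flip: abs_mult)
  also have "\<dots> \<le> real n * real n * sqrt f / (real n * f)"
    using f bound by (intro divide_right_mono) auto
  also have "\<dots> = real n / sqrt f"
  proof -
    have "f = sqrt f * sqrt f" "sqrt f > 0" using f by auto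
    then show ?thesis using n by (simp add: divide_simps)
  qed
  also have "\<dots> \<le> 2 * real n powr (3 / 2) / sqrt f"
  proof -
    have "real n powr 1 \<le> real n powr (3 / 2)" using n by (intro powr_mono) auto
    then have "real n \<le> 2 * real n powr (3 / 2)" using n by simp
    then show ?thesis using f by (intro divide_right_mono) auto
  qed
  finally show ?thesis by (simp add: N_def f_def)
qed

end
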